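(* Let $|||\cdot|||$ be any unitarily invariant norm on the space $\mathbb M(n,\mathbb C)$ of $n\times n$ complex matrices, and let $\|\cdot\|$ be the operator norm. Let $Z$ be a nonsingular $n\times n$ complex matrix, with Mostow decomposition $Z=WP_1P_2$, so that $\varrho_0(Z)=W$, $\varrho_1(Z)=P_1$, $\varrho_2(Z)=P_2$. Let $$\beta(Z)=\int_0^\infty\left\|e^{-t\left((Z^*Z)^{-1}\overline{Z^*Z}\right)^{1/2}}\right\|^2dt.$$ Then $$|||\mathrm{D}\varrho_0(Z)|||\leq\frac{\|P_1^{-1}\|\,\|P_2^{-1}\|}{2}\left(1+\|P_1\|\,\beta(Z)\,\mathrm{cond}(Z)\left(1+\mathrm{cond}(Z)^4\right)\right),$$ $$|||\mathrm{D}\varrho_1(Z)|||\leq\frac{\mathrm{cond}(P_1)\,\|P_2^{-1}\|}{2}\left(1+\|P_1\|\,\beta(Z)\,\mathrm{cond}(Z)\left(1+\mathrm{cond}(Z)^4\right)\right),$$ and $$|||\mathrm{D}\varrho_2(Z)|||\leq\beta(Z)\,\mathrm{cond}(Z)\left(1+\mathrm{cond}(Z)^4\right).$$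
   Context: Mostow's decomposition theorem: every nonsingular complex $n\times n$ matrix $Z$ factors uniquely as $Z=We^{iK}e^{S}$ with $W$ unitary, $K$ real skew-symmetric and $S$ real symmetric. Put $P_1=e^{iK}$ (a complex positive definite matrix satisfying $\overline{P_1}P_1=I$) and $P_2=e^S$ (a real positive definite matrix). By uniqueness, the maps $\varrho_0(Z)=W$, $\varrho_1(Z)=P_1$, $\varrho_2(Z)=P_2$ are well defined on $\mathbb{GL}(n,\mathbb C)$, and they are differentiable. The matrix $(Z^*Z)^{-1}\overline{Z^*Z}$ (bar denotes entrywise complex conjugation) has positive eigenvalues, and its square root is the unique one with positive eigenvalues. $\mathrm{cond}(A)=\|A\|\,\|A^{-1}\|$ is the condition number. A norm is unitarily invariant if $|||UAV|||=|||A|||$ for all matrices $A$ and all unitary $U,V$. For the (real-linear) derivative $\mathrm{D}\varrho_k(Z)$ on $\mathbb M(n,\mathbb C)$, $|||\mathrm{D}\varrho_k(Z)|||=\sup\{|||\mathrm{D}\varrho_k(Z)(A)|||: A\in\mathbb M(n,\mathbb C),\ |||A|||=1\}$. *)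

theory Defs
  imports "HOL-Analysis.Analysis"
begin

definition mconj :: "complex^'n^'m \<Rightarrow> complex^'n^'m"
  where "mconj A = map_matrix cnj A"

definition mstar :: "complex^'n^'m \<Rightarrow> complex^'m^'n"
  where "mstar A = mconj (transpose A)"

definition unitary_mat :: "complex^'n^'n \<Rightarrow> bool"
  where "unitary_mat U \<longleftrightarrow> mstar U ** U = mat 1 \<and> U ** mstar U = mat 1"

definition mat_pow :: "complex^'n^'n \<Rightarrow> nat \<Rightarrow> complex^'n^'n"
  where "mat_pow A k = (((**) A) ^^ k) (mat 1)"

text \<open>The library's \<open>exp\<close> is not available on \<open>complex^'n^'n\<close>: the product \<open>*\<close> there is
  entrywise, while the exponential series needs the matrix product.\<close>
definition mat_exp :: "complex^'n^'n \<Rightarrow> complex^'n^'n"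
  where "mat_exp A = (\<Sum>k. (1 / fact k) *\<^sub>R mat_pow A k)"

definition op_norm :: "complex^'n^'n \<Rightarrow> real"
  where "op_norm A = onorm (\<lambda>x. A *v x)"

definition cond_num :: "complex^'n^'n \<Rightarrow> real"
  where "cond_num A = op_norm A * op_norm (matrix_inv A)"

definition is_eigenvalue :: "complex^'n^'n \<Rightarrow> complex \<Rightarrow> bool"
  where "is_eigenvalue A c \<longleftrightarrow> (\<exists>v. v \<noteq> 0 \<and> A *v v = c *s v)"

text \<open>The square root with positive eigenvalues. The matrix need not be Hermitian.\<close>
definition mat_sqrt :: "complex^'n^'n \<Rightarrow> complex^'n^'n"
  where "mat_sqrt A =
    (THE B. B ** B = A \<and> (\<forall>c. is_eigenvalue B c \<longrightarrow> c \<in> \<real> \<and> Re c > 0))"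

text \<open>\<open>Z = W e\<^sup>i\<^sup>K e\<^sup>S\<close> with \<open>W\<close> unitary, \<open>K\<close> real skew-symmetric, \<open>S\<close> real symmetric,
  \<open>P1 = e\<^sup>i\<^sup>K\<close> and \<open>P2 = e\<^sup>S\<close>.\<close>
definition mostow_decomp ::
  "complex^'n^'n \<Rightarrow> complex^'n^'n \<Rightarrow> complex^'n^'n \<Rightarrow> complex^'n^'n \<Rightarrow> bool"
  where "mostow_decomp Z W P1 P2 \<longleftrightarrow>
    unitary_mat W \<and>
    (\<exists>K::real^'n^'n. transpose K = - K \<and>
        P1 = mat_exp (map_matrix (\<lambda>x. \<i> * complex_of_real x) K)) \<and>
    (\<exists>S::real^'n^'n. transpose S = S \<and>
        P2 = mat_exp (map_matrix complex_of_real S)) \<and>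
    Z = W ** P1 ** P2"

text \<open>By Mostow's theorem the three descriptions below have a unique solution for
  invertible \<open>Z\<close>; the values at singular \<open>Z\<close> are irrelevant, the invertible matrices
  being open.\<close>
definition mostow_rho0 :: "complex^'n^'n \<Rightarrow> complex^'n^'n"
  where "mostow_rho0 Z = (THE W. \<exists>P1 P2. mostow_decomp Z W P1 P2)"

definition mostow_rho1 :: "complex^'n^'n \<Rightarrow> complex^'n^'n"
  where "mostow_rho1 Z = (THE P1. \<exists>W P2. mostow_decomp Z W P1 P2)"

definition mostow_rho2 :: "complex^'n^'n \<Rightarrow> complex^'n^'n"
  where "mostow_rho2 Z = (THE P2. \<exists>W P1. mostow_decomp Z W P1 P2)"

definition mostow_beta :: "complex^'n^'n \<Rightarrow> real"
  where "mostow_beta Z = integral {0..} (\<lambda>t::real.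
    (op_norm (mat_exp ((- t) *\<^sub>R
      mat_sqrt (matrix_inv (mstar Z ** Z) ** mconj (mstar Z ** Z)))))\<^sup>2)"

definition is_matrix_norm :: "(complex^'n^'n \<Rightarrow> real) \<Rightarrow> bool"
  where "is_matrix_norm N \<longleftrightarrow>
    (\<forall>A. N A \<ge> 0) \<and>
    (\<forall>A. N A = 0 \<longleftrightarrow> A = 0) \<and>
    (\<forall>c A. N (map_matrix (\<lambda>z. c * z) A) = cmod c * N A) \<and>
    (\<forall>A B. N (A + B) \<le> N A + N B)"

definition unitarily_invariant_norm :: "(complex^'n^'n \<Rightarrow> real) \<Rightarrow> bool"
  where "unitarily_invariant_norm N \<longleftrightarrow> is_matrix_norm N \<and>
    (\<forall>U A V. unitary_mat U \<and> unitary_mat V \<longrightarrow> N (U ** A ** V) = N A)"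

text \<open>The norm of the real-linear Frechet derivative of \<open>f\<close> at \<open>Z\<close> induced by \<open>N\<close>.\<close>
definition deriv_norm ::
  "(complex^'n^'n \<Rightarrow> real) \<Rightarrow> (complex^'n^'n \<Rightarrow> complex^'n^'n) \<Rightarrow> complex^'n^'n \<Rightarrow> real"
  where "deriv_norm N f Z = (SUP A\<in>{A. N A = 1}. N (frechet_derivative f (at Z) A))"

end

theory Submission
  imports Defs
begin

text \<open>Write \<open>H = Z\<^sup>*Z\<close> and \<open>B = P\<^sub>2\<^sup>-\<^sup>1 P\<^sub>1\<^sup>-\<^sup>2 P\<^sub>2\<close>, which is the square root occurring in \<open>\<beta>(Z)\<close>.
  Then \<open>X = P\<^sub>2\<^sup>2\<close> is the geometric mean of \<open>H\<close> and its conjugate, so the decomposition is unique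
  and is obtained from square roots of positive definite matrices, which depend differentiably on
  \<open>Z\<close>. Differentiating \<open>H = P\<^sub>2 P\<^sub>1\<^sup>2 P\<^sub>2\<close> gives the Lyapunov equation
  \<open>B\<^sup>* dX + dX B = conj dH + B\<^sup>* dH B\<close>, whose solution is bounded by \<open>\<beta>(Z)\<close> times the norm of the
  right-hand side. Since \<open>B = Z\<^sup>-\<^sup>1 V conj Z\<close> with \<open>V\<close> unitary, \<open>\<parallel>B\<parallel> \<le> cond(Z)\<close>, and hence
  \<open>|||dP\<^sub>2||| \<le> \<beta>(Z) cond(Z) (1 + cond(Z)\<^sup>2) |||A|||\<close>, which is better than the claimed bound.
  The bounds for \<open>W\<close> and \<open>P\<^sub>1\<close> do not follow from the claimed bound for \<open>P\<^sub>2\<close> by the triangle inequality: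
  that loses a factor \<open>2\<close>. In the equations for \<open>W\<^sup>* dW\<close> and \<open>dP\<^sub>1\<close> the matrix \<open>dP\<^sub>2\<close> enters only through
  commutators with \<open>P\<^sub>1\<close>, \<open>P\<^sub>1\<^sup>2\<close> and \<open>P\<^sub>2\<^sup>-\<^sup>1\<close>, which are small when the spectra are narrow. This, the
  sharper bound for \<open>dP\<^sub>2\<close>, and \<open>\<beta>(Z) \<ge> \<parallel>P\<^sub>1\<parallel>\<^sup>2/2\<close> make up for the loss.\<close>

subsection \<open>Matrix algebra and singular values\<close>

text \<open>The norm \<open>N\<close> is arbitrary, so no inner product is adapted to it. All
  estimates rest on N(CXD) \<le> op_norm C * N X * op_norm D and on functionals norming a given
  matrix, which turn the integral formula for a Lyapunov solution into an inequality between real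
  integrals. The Lyapunov equation is the linearisation of the Riccati equation X H^-1 X = conj H.
  Conjugating that equation and inverting shows that conj X solves it as well; this is why the
  geometric mean X, and with it its root, is real. There is no room for a lost constant: at Z = 1
  one has op_norm P1 = cond(Z) = 1 and \<beta>(Z) = 1/2, and the two scalar inequalities that
  conclude the bounds for W and P1 become equalities. The commutators have to vanish at that point,
  and so does their estimate, since it measures a commutator by the length of a spectral interval
  and not by a norm.\<close>

lemma mconj_nth [simp]: "mconj A $ i $ j = cnj (A $ i $ j)"
  by (simp add: mconj_def)

lemma mstar_nth [simp]: "mstar A $ i $ j = cnj (A $ j $ i)"
  by (simp add: mstar_def transpose_def)

lemma mstar_mstar [simp]: "mstar (mstar A) = A"
  and mconj_mconj [simp]: "mconj (mconj A) = A"
  and mstar_mconj: "mstar (mconj A) = mconj (mstar A)"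
  and mstar_one [simp]: "mstar (mat 1) = mat 1"
  and mconj_one [simp]: "mconj (mat 1) = mat 1"
  and mstar_add: "mstar (A + B) = mstar A + mstar B"
  and mstar_minus: "mstar (- A) = - mstar A"
  and mstar_scaleR: "mstar (r *\<^sub>R A) = r *\<^sub>R mstar A"
  and mconj_add: "mconj (A + B) = mconj A + mconj B"
  and mconj_diff: "mconj (A - B) = mconj A - mconj B"
  and mconj_scaleR: "mconj (r *\<^sub>R A) = r *\<^sub>R mconj A"
  by (auto simp: vec_eq_iff mat_def)

lemma mstar_mult: "mstar (A ** B) = mstar B ** mstar A"
  by (simp add: vec_eq_iff matrix_matrix_mult_def mult.commute)

lemma mconj_mult: "mconj (A ** B) = mconj A ** mconj B"
  by (simp add: vec_eq_iff matrix_matrix_mult_def)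

lemma matrix_add_rdistrib: "(B + C) ** A = B ** A + C ** A"
  for A :: "complex^'n^'m"
  by (simp add: vec_eq_iff matrix_matrix_mult_def algebra_simps sum.distrib)

lemma matrix_diff_ldistrib: "A ** (B - C) = A ** B - A ** C"
  for A :: "complex^'n^'m"
  by (simp add: vec_eq_iff matrix_matrix_mult_def algebra_simps sum_subtractf)

lemma matrix_diff_rdistrib: "(B - C) ** A = B ** A - C ** A"
  for A :: "complex^'n^'m"
  by (simp add: vec_eq_iff matrix_matrix_mult_def algebra_simps sum_subtractf)

lemma matrix_minus_left: "(- A) ** B = - (A ** B)"
  and matrix_minus_right: "A ** (- B) = - (A ** B)"
  for A :: "complex^'n^'m"
  by (simp_all add: vec_eq_iff matrix_matrix_mult_def sum_negf)

lemma scaleR_matrix_left: "(r *\<^sub>R A) ** B = r *\<^sub>R (A ** B)"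
  and scaleR_matrix_right: "A ** (r *\<^sub>R B) = r *\<^sub>R (A ** B)"
  for A :: "complex^'n^'m"
  by (simp_all add: vec_eq_iff matrix_matrix_mult_def scaleR_sum_right)

lemma matrix_zero_left [simp]: "0 ** A = 0" and matrix_zero_right [simp]: "A ** 0 = 0"
  for A :: "complex^'n^'m"
  by (simp_all add: vec_eq_iff matrix_matrix_mult_def)

lemmas matrix_distribs = matrix_add_ldistrib matrix_add_rdistrib matrix_diff_ldistrib
  matrix_diff_rdistrib matrix_minus_left matrix_minus_right scaleR_matrix_left scaleR_matrix_right

lemma invertible_matrix_inv:
  fixes A :: "complex^'n^'n"
  assumes "invertible A"
  shows "A ** matrix_inv A = mat 1" "matrix_inv A ** A = mat 1"
  using someI_ex[OF assms[unfolded invertible_def]] by (auto simp: matrix_inv_def)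

lemma matrix_inv_eqI:
  fixes A B :: "complex^'n^'n"
  assumes "A ** B = mat 1"
  shows "matrix_inv A = B" "invertible A" "B ** A = mat 1"
proof -
  show *: "B ** A = mat 1" using assms matrix_left_right_inverse by blast
  then show inv: "invertible A" using assms invertible_def by blast
  show "matrix_inv A = B"
    by (metis assms inv invertible_matrix_inv(2) matrix_mul_assoc matrix_mul_lid matrix_mul_rid)
qed

section \<open>Diagonal matrices\<close>

definition dmat :: "('n \<Rightarrow> complex) \<Rightarrow> complex^'n^'n"
  where "dmat d = (\<chi> i j. if i = j then d i else 0)"

lemma dmat_nth: "dmat d $ i $ j = (if i = j then d i else 0)"
  by (simp add: dmat_def)

lemma dmat_mult: "dmat a ** dmat b = dmat (\<lambda>i. a i * b i)"
  by (simp add: vec_eq_iff matrix_matrix_mult_def dmat_nth if_distrib[where f="\<lambda>x. _ * x"]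
      if_distrib[where f="\<lambda>x. x * _"] sum.delta' cong: if_cong)

lemma dmat_one: "dmat (\<lambda>i. 1) = mat 1"
  by (simp add: vec_eq_iff dmat_nth mat_def)

lemma mstar_dmat: "mstar (dmat a) = dmat (\<lambda>i. cnj (a i))"
  by (simp add: vec_eq_iff dmat_nth)

lemma mconj_dmat: "mconj (dmat a) = dmat (\<lambda>i. cnj (a i))"
  by (simp add: vec_eq_iff dmat_nth)

lemma dmat_add: "dmat a + dmat b = dmat (\<lambda>i. a i + b i)"
  and dmat_diff: "dmat a - dmat b = dmat (\<lambda>i. a i - b i)"
  and dmat_scaleR: "r *\<^sub>R dmat a = dmat (\<lambda>i. of_real r * a i)"
  by (simp_all add: vec_eq_iff dmat_nth scaleR_conv_of_real[where 'a=complex])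

lemma dmat_mult_vec: "dmat d *v x = (\<chi> i. d i * x $ i)"
  by (simp add: vec_eq_iff matrix_vector_mult_def dmat_nth
      if_distrib[where f="\<lambda>x. x * _"] cong: if_cong)

lemma mult_dmat_nth: "(A ** dmat d) $ i $ j = A $ i $ j * d j"
  by (simp add: matrix_matrix_mult_def dmat_nth if_distrib[where f="\<lambda>x. _ * x"] cong: if_cong)

lemma matrix_mult_column: "(A ** B) $ i $ j = (A *v column j B) $ i"
  by (simp add: matrix_matrix_mult_def matrix_vector_mult_def column_def)

text \<open>The library's inner product on complex vectors is the real part of this one.\<close>
definition hinner :: "complex^'n \<Rightarrow> complex^'n \<Rightarrow> complex"
  where "hinner x y = (\<Sum>i\<in>UNIV. cnj (x $ i) * y $ i)"

lemma inner_eq_hinner: "inner x y = Re (hinner x y)"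
  by (simp add: hinner_def inner_vec_def inner_complex_def)

lemma hinner_scale: "hinner x (c *s y) = c * hinner x y"
  by (simp add: hinner_def sum_distrib_left algebra_simps)

lemma hinner_scale_left: "hinner (c *s x) y = cnj c * hinner x y"
  by (simp add: hinner_def sum_distrib_left algebra_simps)

lemma hinner_add: "hinner x (y + z) = hinner x y + hinner x z"
  by (simp add: hinner_def sum.distrib algebra_simps)

lemma hinner_scaleR: "hinner x (r *\<^sub>R y) = r *\<^sub>R hinner x y"
  by (simp add: hinner_def scaleR_sum_right)

lemma hinner_zero: "hinner x 0 = 0"
  by (simp add: hinner_def)

lemma cnj_hinner: "cnj (hinner x y) = hinner y x"
  by (simp add: hinner_def mult.commute)

lemma hinner_mstar: "hinner (A *v x) y = hinner x (mstar A *v y)"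
proof -
  have "hinner (A *v x) y = (\<Sum>i\<in>UNIV. \<Sum>j\<in>UNIV. cnj (A$i$j) * cnj (x$j) * (y$i))"
    by (simp add: hinner_def matrix_vector_mult_def sum_distrib_right)
  also have "\<dots> = (\<Sum>j\<in>UNIV. \<Sum>i\<in>UNIV. cnj (A$i$j) * cnj (x$j) * (y$i))"
    by (rule sum.swap)
  also have "\<dots> = hinner x (mstar A *v y)"
    by (simp add: hinner_def matrix_vector_mult_def sum_distrib_left algebra_simps)
  finally show ?thesis .
qed

lemma inner_mstar: "inner (A *v x) y = inner x (mstar A *v y)"
  for A :: "complex^'n^'n"
  by (simp add: inner_eq_hinner hinner_mstar)

lemma hinner_self: "hinner x x = of_real ((norm x)\<^sup>2)"
proof -
  have "hinner x x = of_real (\<Sum>i\<in>UNIV. (cmod (x $ i))\<^sup>2)"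
    unfolding hinner_def of_real_sum
    by (rule sum.cong[OF refl]) (metis complex_norm_square mult.commute)
  also have "(\<Sum>i\<in>UNIV. (cmod (x $ i))\<^sup>2) = (norm x)\<^sup>2"
    by (simp add: norm_vec_def L2_set_def sum_nonneg)
  finally show ?thesis .
qed

section \<open>Orthonormal families, the spectral theorem and singular values\<close>

text \<open>Families are indexed by the coordinate type itself, and \<open>J\<close> records which
  members are already orthonormal; a completed family is then directly the family of columns of a
  square matrix.\<close>

definition orthonormal_on :: "'n set \<Rightarrow> ('n \<Rightarrow> complex^'n) \<Rightarrow> bool"
  where "orthonormal_on J f \<longleftrightarrow> (\<forall>i\<in>J. \<forall>j\<in>J. hinner (f i) (f j) = (if i = j then 1 else 0))"

text \<open>The square matrix with rows conj (f j) for j in \<open>J\<close> and zero rows elsewhere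
  misses the coordinate \<open>k\<close>, so it is not surjective and hence not injective. Any
  nonzero kernel vector will do.\<close>

lemma orthogonal_vector_exists:
  fixes f :: "'n \<Rightarrow> complex^'n"
  assumes "k \<notin> J"
  obtains x where "x \<noteq> 0" "\<And>j. j \<in> J \<Longrightarrow> hinner (f j) x = 0"
proof -
  define M where "M = (\<chi> i l. if i \<in> J then cnj (f i $ l) else 0)"
  have comp: "(M *v x) $ i = (if i \<in> J then hinner (f i) x else 0)" for x i
    by (auto simp: M_def matrix_vector_mult_def hinner_def)
  have "\<not> (\<exists>B. M ** B = mat 1)"
  proof
    assume "\<exists>B. M ** B = mat 1"
    then obtain B where B: "M ** B = mat 1" by blast
    have "(M *v (B *v axis k 1)) $ k = 1"
      by (simp add: matrix_vector_mul_assoc B axis_def)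
    then show False using assms comp by auto
  qed
  then have "\<not> (\<exists>B. B ** M = mat 1)" using matrix_left_right_inverse by blast
  then obtain x where "M *v x = 0" "x \<noteq> 0" using matrix_left_invertible_ker[of M] by auto
  then show ?thesis using that comp by (metis zero_index)
qed

lemma orthonormal_extend:
  fixes f :: "'n \<Rightarrow> complex^'n"
  assumes "orthonormal_on J f"
  obtains g where "orthonormal_on UNIV g" "\<And>j. j \<in> J \<Longrightarrow> g j = f j"
proof -
  have "\<exists>g. orthonormal_on (J \<union> K) g \<and> (\<forall>j\<in>J. g j = f j)" if "finite K" "K \<inter> J = {}" for K
    using that
  proof (induction K rule: finite_induct)
    case empty then show ?case using assms by auto
  next
    case (insert k K)
    then obtain g where g: "orthonormal_on (J \<union> K) g" "\<forall>j\<in>J. g j = f j" by auto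
    have k: "k \<notin> J \<union> K" using insert by auto
    obtain x where x: "x \<noteq> 0" "\<And>j. j \<in> J \<union> K \<Longrightarrow> hinner (g j) x = 0"
      using orthogonal_vector_exists[OF k, of g] by blast
    define u where "u = of_real (1 / norm x) *s x"
    have "hinner u u = of_real (1 / norm x) * (of_real (1 / norm x) * hinner x x)"
      by (simp add: u_def hinner_scale hinner_scale_left)
    also have "\<dots> = 1" using x(1) by (simp add: hinner_self power2_eq_square)
    finally have u: "hinner u u = 1" "\<And>j. j \<in> J \<union> K \<Longrightarrow> hinner (g j) u = 0"
      using x(2) by (auto simp: u_def hinner_scale)
    then have u': "hinner u (g j) = 0" if "j \<in> J \<union> K" for j using that
      by (metis cnj_hinner complex_cnj_zero)
    have "orthonormal_on (J \<union> insert k K) (g(k := u))"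
      using g(1) u u' k unfolding orthonormal_on_def by auto
    moreover have "\<forall>j\<in>J. (g(k := u)) j = f j" using g k by auto
    ultimately show ?case by blast
  qed
  from this[of "- J"] obtain g where "orthonormal_on (J \<union> - J) g" "\<forall>j\<in>J. g j = f j"
    by auto
  then show ?thesis using that by auto
qed

text \<open>A maximiser of the Rayleigh quotient on the unit sphere of \<open>V\<close> is an
  eigenvector. Working in a real Euclidean space covers Hermitian matrices through the real part of
  the Hermitian product and makes the eigenvalue real from the start.\<close>

lemma rayleigh_eigenvector:
  fixes f :: "'a::euclidean_space \<Rightarrow> 'a"
  assumes lin: "linear f" and sym: "\<And>x y. inner (f x) y = inner x (f y)"
    and V: "subspace V" and inv: "\<And>x. x \<in> V \<Longrightarrow> f x \<in> V" and ne: "v \<in> V" "v \<noteq> 0"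
  obtains u l where "u \<in> V" "norm u = 1" "f u = l *\<^sub>R u"
proof -
  interpret linear f by fact
  let ?K = "V \<inter> sphere 0 1"
  have "compact ?K" using closed_subspace[OF V] by (simp add: closed_Int_compact)
  moreover have "(1 / norm v) *\<^sub>R v \<in> ?K" using ne V by (auto intro: subspace_mul)
  then have "?K \<noteq> {}" by blast
  moreover have "continuous_on ?K (\<lambda>x. inner x (f x))"
    using lin by (intro continuous_intros linear_continuous_on) (simp add: linear_conv_bounded_linear)
  ultimately obtain u where u: "u \<in> ?K" and max: "\<And>y. y \<in> ?K \<Longrightarrow> inner y (f y) \<le> inner u (f u)"
    using continuous_attains_sup[of ?K "\<lambda>x. inner x (f x)"] by blast
  define l where "l = inner u (f u)"
  have le: "inner y (f y) \<le> l * inner y y" if "y \<in> V" for y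
  proof (cases "y = 0")
    case False
    have "inner ((1/norm y) *\<^sub>R y) (f ((1/norm y) *\<^sub>R y)) \<le> l"
      unfolding l_def using that V False by (intro max) (auto intro: subspace_mul)
    then have "inner y (f y) / (norm y)\<^sup>2 \<le> l" by (simp add: scale power2_eq_square)
    then show ?thesis using False by (simp add: divide_le_eq power2_norm_eq_inner)
  qed simp
  define w where "w = f u - l *\<^sub>R u"
  have nu: "norm u = 1" using u by auto
  have wV: "w \<in> V" unfolding w_def using u V inv by (auto intro: subspace_diff subspace_mul)
  \<comment> \<open>Moving the maximiser \<open>u\<close> along the residual \<open>w\<close> gains
    a term linear in \<open>t\<close> and costs only a quadratic one; small \<open>t\<close> then
    forces \<open>w = 0\<close>.\<close>
  have ineq: "2 * t * inner w w \<le> t^2 * (l * inner w w - inner w (f w))" for t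
  proof -
    have "u + t *\<^sub>R w \<in> V" using u wV V by (auto intro: subspace_add subspace_mul)
    from le[OF this] have "l + 2 * t * inner w (f u) + t^2 * inner w (f w)
      \<le> l * (1 + 2 * t * inner w u + t^2 * inner w w)"
      using nu sym[of u w] by (simp add: add scale inner_add_left inner_add_right l_def
        inner_commute norm_eq_1 power2_eq_square algebra_simps)
    moreover have "inner w w = inner w (f u) - l * inner w u"
      by (simp add: w_def inner_diff_right)
    then have "2 * t * inner w w = 2 * t * inner w (f u) - 2 * t * (l * inner w u)"
      by (simp add: right_diff_distrib)
    ultimately show ?thesis by (simp add: algebra_simps)
  qed
  have "w = 0"
  proof (rule ccontr)
    assume "w \<noteq> 0"
    then have pos: "inner w w > 0" by simp
    define c where "c = \<bar>l * inner w w - inner w (f w)\<bar> + 1"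
    have c: "c > 0" "l * inner w w - inner w (f w) < c" by (auto simp: c_def)
    define t where "t = inner w w / c"
    have t: "t > 0" using pos c by (simp add: t_def)
    have "2 * t * inner w w \<le> t^2 * c"
      using ineq[of t] c t by (smt (verit) mult_left_mono zero_le_power2)
    then have "2 * inner w w \<le> t * c" using t by (simp add: power2_eq_square)
    then show False using c pos by (simp add: t_def)
  qed
  then have "f u = l *\<^sub>R u" by (simp add: w_def)
  then show ?thesis using that u nu by blast
qed

text \<open>The orthogonal complement of the eigenvectors found so far is invariant because
  \<open>A\<close> is Hermitian, and it is nonzero as long as an index is left.\<close>

lemma hermitian_orthonormal_eigenvectors:
  fixes A :: "complex^'n^'n"
  assumes A: "mstar A = A"
  obtains f d where "orthonormal_on UNIV f" "\<And>j. A *v f j = of_real (d j) *s f j"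
proof -
  have "\<exists>f d. orthonormal_on J f \<and> (\<forall>j\<in>J. A *v f j = of_real (d j) *s f j)" if "finite J" for J :: "'n set"
    using that
  proof (induction J rule: finite_induct)
    case empty then show ?case by (simp add: orthonormal_on_def)
  next
    case (insert k J)
    from insert.IH obtain f d where "orthonormal_on J f \<and> (\<forall>j\<in>J. A *v f j = of_real (d j) *s f j)"
      by (elim exE)
    then have f: "orthonormal_on J f" "\<And>j. j \<in> J \<Longrightarrow> A *v f j = of_real (d j) *s f j"
      by simp_all
    let ?V = "{x. \<forall>j\<in>J. hinner (f j) x = 0}"
    obtain v where "v \<noteq> 0" "\<And>j. j \<in> J \<Longrightarrow> hinner (f j) v = 0"
      using orthogonal_vector_exists[OF \<open>k \<notin> J\<close>] by blast
    then have v: "v \<noteq> 0" "v \<in> ?V" by simp_all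
    have sV: "subspace ?V"
      by (simp add: subspace_def hinner_add hinner_scaleR hinner_zero)
    have iV: "A *v x \<in> ?V" if "x \<in> ?V" for x
    proof -
      have "hinner (f j) (A *v x) = hinner (A *v f j) x" if "j \<in> J" for j
        using hinner_mstar[of A "f j" x] unfolding A by (rule sym)
      then show ?thesis using that f by (simp add: hinner_scale_left)
    qed
    have sym: "inner (A *v x) y = inner x (A *v y)" for x y
      using inner_mstar[of A x y] unfolding A .
    obtain u l where u: "u \<in> ?V" "norm u = 1" "A *v u = l *\<^sub>R u"
      by (rule rayleigh_eigenvector[OF matrix_vector_mul_linear[of A] sym sV iV v(2) v(1)])
    have "A *v u = of_real l *s u" unfolding u(3) by (simp add: vec_eq_iff scaleR_conv_of_real[where 'a=complex])
    moreover have "hinner u u = 1" by (simp add: hinner_self u(2))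
    moreover have "hinner (f j) u = 0 \<and> hinner u (f j) = 0" if "j \<in> J" for j
      using that u(1) cnj_hinner[of "f j" u] by auto
    moreover have "j \<noteq> k" "k \<noteq> j" if "j \<in> J" for j using that \<open>k \<notin> J\<close> by auto
    ultimately have "orthonormal_on (insert k J) (f(k := u)) \<and>
       (\<forall>j\<in>insert k J. A *v (f(k := u)) j = of_real ((d(k := l)) j) *s (f(k := u)) j)"
      using f unfolding orthonormal_on_def by simp
    then show ?case by (intro exI)
  qed
  from this[of UNIV, OF finite] obtain f d
    where "orthonormal_on UNIV f \<and> (\<forall>j\<in>UNIV. A *v f j = of_real (d j) *s f j)"
    by (elim exE)
  then show ?thesis using that[of f d] by simp
qed

lemma unitary_of_orthonormal:
  assumes "orthonormal_on UNIV f"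
  shows "unitary_mat (\<chi> i j. f j $ i)"
proof -
  have "mstar (\<chi> i j. f j $ i) ** (\<chi> i j. f j $ i) = mat 1"
    using assms by (simp add: vec_eq_iff matrix_matrix_mult_def mat_def orthonormal_on_def hinner_def)
  then show ?thesis unfolding unitary_mat_def using matrix_left_right_inverse by blast
qed

lemma unitary_matI: "mstar U ** U = mat 1 \<Longrightarrow> unitary_mat U"
  unfolding unitary_mat_def using matrix_left_right_inverse by blast

lemma unitaryD:
  assumes "unitary_mat U" shows "mstar U ** U = mat 1" "U ** mstar U = mat 1"
    "mstar U ** (U ** A) = A" "U ** (mstar U ** A) = A"
    "A ** mstar U ** U = A" "A ** U ** mstar U = A"
  using assms by (auto simp: unitary_mat_def matrix_mul_assoc) (auto simp flip: matrix_mul_assoc)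

lemma unitary_mstar: "unitary_mat U \<Longrightarrow> unitary_mat (mstar U)"
  by (auto simp: unitary_mat_def)

lemma unitary_mconj: "unitary_mat U \<Longrightarrow> unitary_mat (mconj U)"
  unfolding unitary_mat_def by (metis mconj_mult mconj_one mstar_mconj)

lemma unitary_mult: "unitary_mat U \<Longrightarrow> unitary_mat V \<Longrightarrow> unitary_mat (U ** V)"
  by (rule unitary_matI) (simp add: mstar_mult unitaryD matrix_mul_assoc)

lemma unitary_one: "unitary_mat (mat 1)"
  by (simp add: unitary_mat_def)

lemma hermitian_diagonalization:
  fixes A :: "complex^'n^'n"
  assumes "mstar A = A"
  obtains U d where "unitary_mat U" "A = U ** dmat (\<lambda>i. of_real (d i)) ** mstar U"
proof -
  obtain f d where f: "orthonormal_on UNIV f" "\<And>j. A *v f j = of_real (d j) *s f j"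
    using hermitian_orthonormal_eigenvectors[OF assms] by blast
  define U where "U = (\<chi> i j. f j $ i)"
  have U: "unitary_mat U" unfolding U_def using f by (intro unitary_of_orthonormal)
  have col: "column j U = f j" for j by (simp add: U_def column_def vec_eq_iff)
  have "A ** U = U ** dmat (\<lambda>i. of_real (d i))"
    unfolding vec_eq_iff matrix_mult_column[of A] mult_dmat_nth col f(2) by (simp add: U_def mult.commute)
  then have "A = U ** dmat (\<lambda>i. of_real (d i)) ** mstar U"
    by (metis U unitaryD(6))
  then show ?thesis using that U by blast
qed

text \<open>For an eigenbasis \<open>f\<close> of \<open>mstar A ** A\<close> the vectors A (f j)
  are orthogonal with lengths \<open>s j\<close>. Those of nonzero length are normalised; the others
  are replaced by an arbitrary orthonormal completion, which is harmless since A (f j) = 0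
  there.\<close>

lemma singular_value_decomposition:
  fixes A :: "complex^'n^'n"
  obtains U V s where "unitary_mat U" "unitary_mat V" "\<And>i. s i \<ge> (0::real)"
    "A = U ** dmat (\<lambda>i. of_real (s i)) ** V"
proof -
  have "mstar (mstar A ** A) = mstar A ** A" by (simp add: mstar_mult)
  from hermitian_orthonormal_eigenvectors[OF this] obtain f d where f: "orthonormal_on UNIV f"
    "\<And>j. (mstar A ** A) *v f j = of_real (d j) *s f j" by blast
  have hA: "hinner (A *v f i) (A *v f j) = (if i = j then of_real (d j) else 0)" for i j
    using f by (simp add: hinner_mstar matrix_vector_mul_assoc hinner_scale orthonormal_on_def)
  then have "complex_of_real (d i) = of_real ((norm (A *v f i))\<^sup>2)" for i
    using hinner_self[of "A *v f i"] by simp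
  then have d: "d i = (norm (A *v f i))\<^sup>2" for i using of_real_eq_iff by blast
  define s where "s i = norm (A *v f i)" for i
  define J where "J = {j. s j \<noteq> 0}"
  define h where "h j = of_real (1 / s j) *s (A *v f j)" for j
  have oJ: "orthonormal_on J h"
    unfolding orthonormal_on_def h_def
    by (auto simp: hinner_scale hinner_scale_left hA d s_def[symmetric] J_def power2_eq_square)
  obtain g where g: "orthonormal_on UNIV g" "\<And>j. j \<in> J \<Longrightarrow> g j = h j"
    using orthonormal_extend[OF oJ] by blast
  have Af: "A *v f j = of_real (s j) *s g j" for j
    using g(2)[of j] unfolding h_def by (cases "j \<in> J") (auto simp: J_def s_def)
  define U where "U = (\<chi> i j. g j $ i)"
  define V where "V = (\<chi> i j. f j $ i)"
  have U: "unitary_mat U" and V: "unitary_mat V"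
    unfolding U_def V_def using f g by (auto intro: unitary_of_orthonormal)
  have col: "column j V = f j" for j by (simp add: V_def column_def vec_eq_iff)
  have "A ** V = U ** dmat (\<lambda>i. of_real (s i))"
    unfolding vec_eq_iff matrix_mult_column[of A] mult_dmat_nth col Af by (simp add: U_def mult.commute)
  then have "A = U ** dmat (\<lambda>i. of_real (s i)) ** mstar V"
    by (metis V unitaryD(6))
  moreover have "s i \<ge> 0" for i by (simp add: s_def)
  ultimately show ?thesis using that U unitary_mstar[OF V] by blast
qed

subsection \<open>Unitarily invariant norms\<close>

lemma op_norm_bound: "norm (A *v x) \<le> op_norm A * norm x"
  unfolding op_norm_def by (rule onorm[OF matrix_vector_mul_bounded_linear])

lemma op_norm_nonneg: "op_norm A \<ge> 0"
  unfolding op_norm_def by (rule onorm_pos_le[OF matrix_vector_mul_bounded_linear])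

lemma op_norm_leI: "0 \<le> b \<Longrightarrow> (\<And>x. norm (A *v x) \<le> b * norm x) \<Longrightarrow> op_norm A \<le> b"
  unfolding op_norm_def by (rule onorm_bound)

lemma op_norm_mult: "op_norm (A ** B) \<le> op_norm A * op_norm B"
proof (rule op_norm_leI)
  fix x
  have "norm (A *v (B *v x)) \<le> op_norm A * (op_norm B * norm x)"
    by (rule order_trans[OF op_norm_bound]) (intro mult_left_mono op_norm_bound op_norm_nonneg)
  then show "norm ((A ** B) *v x) \<le> op_norm A * op_norm B * norm x"
    by (simp add: matrix_vector_mul_assoc)
qed (simp add: op_norm_nonneg)

lemma norm_unitary_vec: "unitary_mat U \<Longrightarrow> norm (U *v x) = norm x"
  unfolding norm_eq_sqrt_inner inner_mstar by (simp add: matrix_vector_mul_assoc unitaryD)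

lemma op_norm_unitary_le: "unitary_mat U \<Longrightarrow> op_norm U \<le> 1"
  by (rule op_norm_leI) (simp_all add: norm_unitary_vec)

lemma op_norm_unitary_mult:
  assumes "unitary_mat U" "unitary_mat V"
  shows "op_norm (U ** A ** V) = op_norm A"
proof -
  have le: "op_norm (U ** A ** V) \<le> op_norm A" if "unitary_mat U" "unitary_mat V"
    for A U V :: "complex^'n^'n"
  proof (rule op_norm_leI[OF op_norm_nonneg])
    fix x
    have "norm ((U ** A ** V) *v x) = norm (A *v (V *v x))"
      using that(1) by (simp add: matrix_vector_mul_assoc[symmetric] norm_unitary_vec)
    also have "\<dots> \<le> op_norm A * norm x"
      using op_norm_bound[of A "V *v x"] norm_unitary_vec[OF that(2), of x] by simp
    finally show "norm ((U ** A ** V) *v x) \<le> op_norm A * norm x" .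
  qed
  have "A = mstar U ** (U ** A ** V) ** mstar V"
    using assms by (metis matrix_mul_assoc unitaryD(3,6))
  then have "op_norm A \<le> op_norm (U ** A ** V)"
    using le[OF unitary_mstar[OF assms(1)] unitary_mstar[OF assms(2)], of "U ** A ** V"] by simp
  with le[OF assms, of A] show ?thesis by simp
qed

lemma op_norm_dmat_ge: "cmod (d i) \<le> op_norm (dmat d)"
proof -
  have "dmat d *v axis i 1 = axis i (d i)"
    by (auto simp: dmat_mult_vec vec_eq_iff axis_def)
  moreover have "norm (axis i c) = cmod c" for c :: complex
    by (simp add: norm_vec_def L2_set_def axis_def if_distrib[where f="\<lambda>z. (cmod z)\<^sup>2"] cong: if_cong)
  ultimately show ?thesis using op_norm_bound[of "dmat d" "axis i 1"] by simp
qed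

lemma op_norm_dmat_le:
  assumes "0 \<le> b" "\<And>i. cmod (d i) \<le> b"
  shows "op_norm (dmat d) \<le> b"
proof (rule op_norm_leI[OF assms(1)])
  fix x
  have "norm (dmat d *v x) \<le> norm (b *\<^sub>R x)"
    unfolding norm_vec_def using assms
    by (intro L2_set_mono) (auto simp: dmat_mult_vec norm_mult intro: mult_right_mono)
  then show "norm (dmat d *v x) \<le> b * norm x" using assms by simp
qed

lemma norm_scale_vec: "norm (c *s y) = cmod c * norm y" for y :: "complex^'n"
  by (simp add: norm_vec_def L2_set_def norm_mult power_mult_distrib sum_distrib_left[symmetric]
      real_sqrt_mult)

lemma ui_op_norm: "unitarily_invariant_norm (op_norm :: complex^'n^'n \<Rightarrow> real)"
  unfolding unitarily_invariant_norm_def is_matrix_norm_def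
proof (intro conjI allI impI)
  fix A B U V :: "complex^'n^'n" and c
  show "op_norm A \<ge> 0" by (rule op_norm_nonneg)
  show "op_norm A = 0 \<longleftrightarrow> A = 0"
    unfolding op_norm_def onorm_eq_0[OF matrix_vector_mul_bounded_linear]
    by (metis matrix_eq matrix_vector_mult_0)
  have "(\<lambda>x. map_matrix ((*) c) A *v x) = (\<lambda>x. c *s (A *v x))"
    by (simp add: vec_eq_iff fun_eq_iff matrix_vector_mult_def sum_distrib_left mult.assoc)
  moreover have "onorm (\<lambda>x. c *s (A *v x)) = onorm (\<lambda>x. cmod c *\<^sub>R (A *v x))"
    by (simp add: onorm_def norm_scale_vec)
  moreover have "\<dots> = cmod c * onorm (\<lambda>x. A *v x)"
    using onorm_scaleR[OF matrix_vector_mul_bounded_linear, of "cmod c" A] by simp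
  ultimately show "op_norm (map_matrix (\<lambda>z. c * z) A) = cmod c * op_norm A"
    by (simp add: op_norm_def)
  show "op_norm (A + B) \<le> op_norm A + op_norm B"
    unfolding op_norm_def matrix_vector_mult_add_rdistrib
    by (rule onorm_triangle[OF matrix_vector_mul_bounded_linear matrix_vector_mul_bounded_linear])
  assume "unitary_mat U \<and> unitary_mat V"
  then show "op_norm (U ** A ** V) = op_norm A" by (intro op_norm_unitary_mult) blast+
qed

lemma norm_matrix_trace: "(norm A)\<^sup>2 = Re (trace (mstar A ** A))" for A :: "complex^'n^'n"
proof -
  have "(norm A)\<^sup>2 = (\<Sum>i\<in>UNIV. \<Sum>j\<in>UNIV. (cmod (A $ i $ j))\<^sup>2)"
    by (simp add: norm_vec_def L2_set_def sum_nonneg)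
  also have "\<dots> = (\<Sum>j\<in>UNIV. \<Sum>i\<in>UNIV. (cmod (A $ i $ j))\<^sup>2)" by (rule sum.swap)
  also have "\<dots> = (\<Sum>j\<in>UNIV. \<Sum>i\<in>UNIV. Re (cnj (A $ i $ j) * A $ i $ j))"
    by (simp add: cmod_power2 flip: power2_eq_square)
  also have "\<dots> = Re (trace (mstar A ** A))"
    by (simp add: trace_def matrix_matrix_mult_def)
  finally show ?thesis .
qed

text \<open>The norm that defines Frechet derivatives is the Frobenius norm on matrices. As an
  instance of \<open>ui_norm\<close> it inherits the Sylvester bound and the product estimates that
  the differentiability proofs use.\<close>

lemma ui_norm_frobenius: "unitarily_invariant_norm (norm :: complex^'n^'n \<Rightarrow> real)"
  unfolding unitarily_invariant_norm_def is_matrix_norm_def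
proof (intro conjI allI impI)
  fix A B U V :: "complex^'n^'n" and c
  show "norm A \<ge> 0" by simp
  show "norm A = 0 \<longleftrightarrow> A = 0" by simp
  show "norm (map_matrix (\<lambda>z. c * z) A) = cmod c * norm A"
    by (simp add: norm_vec_def L2_set_def norm_mult power_mult_distrib sum_distrib_left[symmetric]
        real_sqrt_mult sum_nonneg)
  show "norm (A + B) \<le> norm A + norm B" by (rule norm_triangle_ineq)
  assume uv: "unitary_mat U \<and> unitary_mat V"
  have "mstar (U ** A ** V) ** (U ** A ** V) = mstar V ** (mstar A ** A ** V)"
    using uv by (simp add: mstar_mult matrix_mul_assoc[symmetric] unitaryD)
  then have "trace (mstar (U ** A ** V) ** (U ** A ** V)) = trace (mstar A ** A)"
    using uv by (simp add: trace_mul_sym[of "mstar V"] matrix_mul_assoc[symmetric] unitaryD(2))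
  then have "(norm (U ** A ** V))\<^sup>2 = (norm A)\<^sup>2" by (simp add: norm_matrix_trace)
  then show "norm (U ** A ** V) = norm A" by simp
qed

section \<open>Consequences of unitary invariance\<close>

locale ui_norm =
  fixes N :: "complex^'n^'n \<Rightarrow> real"
  assumes ui: "unitarily_invariant_norm N"
begin

lemma N_nonneg: "N A \<ge> 0"
  and N_eq_0: "N A = 0 \<longleftrightarrow> A = 0"
  and N_scale: "N (map_matrix (\<lambda>z. c * z) A) = cmod c * N A"
  and N_triangle: "N (A + B) \<le> N A + N B"
  and N_unitary: "unitary_mat U \<Longrightarrow> unitary_mat V \<Longrightarrow> N (U ** A ** V) = N A"
  using ui by (auto simp: unitarily_invariant_norm_def is_matrix_norm_def)

lemma N_unitary_left: "unitary_mat U \<Longrightarrow> N (U ** A) = N A"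
  using N_unitary[of U "mat 1" A] by (simp add: unitary_one)

lemma N_scaleR: "N (r *\<^sub>R A) = \<bar>r\<bar> * N A"
proof -
  have "r *\<^sub>R A = map_matrix (\<lambda>z. of_real r * z) A"
    by (simp add: vec_eq_iff scaleR_conv_of_real[where 'a=complex])
  then show ?thesis using N_scale[of "of_real r" A] by simp
qed

lemma N_minus: "N (- A) = N A"
  using N_scaleR[of "-1" A] by simp

lemma N_diff: "N (A - B) \<le> N A + N B"
  using N_triangle[of A "- B"] by (simp add: N_minus)

lemma N_zero: "N 0 = 0"
  by (simp add: N_eq_0)

text \<open>A matrix and its adjoint share the real diagonal factor of a singular value
  decomposition, and \<open>N\<close> sees only that factor. The same holds for the
  conjugate.\<close>

lemma N_mstar: "N (mstar A) = N A"
proof -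
  obtain U V s where "unitary_mat U" "unitary_mat V" "A = U ** dmat (\<lambda>i. complex_of_real (s i)) ** V"
    by (rule singular_value_decomposition)
  then show ?thesis
    by (simp add: mstar_mult mstar_dmat N_unitary unitary_mstar matrix_mul_assoc)
qed

lemma N_mconj: "N (mconj A) = N A"
proof -
  obtain U V s where "unitary_mat U" "unitary_mat V" "A = U ** dmat (\<lambda>i. complex_of_real (s i)) ** V"
    by (rule singular_value_decomposition)
  then show ?thesis
    by (simp add: mconj_mult mconj_dmat N_unitary unitary_mconj)
qed

text \<open>A contraction with singular values \<open>t \<in> [0,1]\<close> is the average of the two unitary matrices
  with \<open>t\<close> replaced by \<open>t \<plusminus> \<i> \<sqrt>(1 - t\<^sup>2)\<close>.\<close>
lemma N_mult_left: "N (C ** X) \<le> op_norm C * N X"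
proof -
  obtain U V s where U: "unitary_mat U" and V: "unitary_mat V" and s: "\<And>i. s i \<ge> 0"
    and C: "C = U ** dmat (\<lambda>i. complex_of_real (s i)) ** V"
    using singular_value_decomposition[of C] by metis
  define r where "r = op_norm C"
  have op: "op_norm (dmat (\<lambda>i. complex_of_real (s i))) = r"
    unfolding r_def C by (simp add: op_norm_unitary_mult U V)
  have sr: "s i \<le> r" for i
    using op_norm_dmat_ge[of "\<lambda>i. complex_of_real (s i)" i] s[of i] unfolding op by simp
  show ?thesis
  proof (cases "r = 0")
    case True
    then have "s i = 0" for i using sr[of i] s[of i] by simp
    then have "dmat (\<lambda>i. complex_of_real (s i)) = 0" by (simp add: vec_eq_iff dmat_nth)
    then have "C = 0" by (simp add: C)
    then show ?thesis by (simp add: N_zero N_nonneg op_norm_nonneg)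
  next
    case False
    then have r: "r > 0" using op_norm_nonneg[of C] r_def by simp
    define t where "t i = s i / r" for i
    have t: "0 \<le> t i" "t i \<le> 1" for i using s sr r by (auto simp: t_def divide_le_eq)
    have t2: "0 \<le> 1 - (t i)\<^sup>2" for i using t[of i] by (simp add: power_le_one)
    define E where "E = dmat (\<lambda>i. Complex (t i) (sqrt (1 - (t i)\<^sup>2)))"
    have E: "unitary_mat E"
    proof (rule unitary_matI)
      show "mstar E ** E = mat 1"
        using t2 by (auto simp: E_def mstar_dmat dmat_mult dmat_one[symmetric] complex_eq_iff
            power2_eq_square intro!: arg_cong[where f=dmat])
    qed
    have "dmat (\<lambda>i. complex_of_real (s i)) = (r / 2) *\<^sub>R (E + mstar E)"
      using r by (auto simp: E_def mstar_dmat dmat_add dmat_scaleR complex_eq_iff t_def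
          intro!: arg_cong[where f=dmat])
    then have "C ** X = (r / 2) *\<^sub>R (U ** (E ** (V ** X)) + U ** (mstar E ** (V ** X)))"
      by (simp add: C matrix_distribs matrix_mul_assoc scaleR_add_right)
    moreover have "N (U ** (E ** (V ** X)) + U ** (mstar E ** (V ** X))) \<le> N X + N X"
      by (rule order_trans[OF N_triangle]) (simp add: N_unitary_left U V E unitary_mstar)
    ultimately show ?thesis using r by (simp add: N_scaleR r_def[symmetric])
  qed
qed

end

interpretation op_norm: ui_norm op_norm
  by unfold_locales (rule ui_op_norm)

interpretation frobenius: ui_norm norm
  by unfold_locales (rule ui_norm_frobenius)

context ui_norm
begin

lemma N_mult_right: "N (X ** C) \<le> op_norm C * N X"
  using N_mult_left[of "mstar C" "mstar X"]
  by (simp add: N_mstar op_norm.N_mstar mstar_mult[symmetric])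

lemma N_mult_mult: "N (B ** X ** C) \<le> op_norm B * N X * op_norm C"
  using order_trans[OF N_mult_right[of "B ** X" C] mult_left_mono[OF N_mult_left[of B X] op_norm_nonneg]]
  by (simp add: mult_ac)

text \<open>Serves continuity: a finite convex function on a finite-dimensional space is continuous,
  so operator norms of continuous matrix functions can be integrated.\<close>

lemma N_convex: "convex_on UNIV N"
proof (rule convex_onI)
  fix t x y assume t: "(0::real) < t" "t < 1"
  have "N ((1 - t) *\<^sub>R x + t *\<^sub>R y) \<le> N ((1 - t) *\<^sub>R x) + N (t *\<^sub>R y)" by (rule N_triangle)
  then show "N ((1 - t) *\<^sub>R x + t *\<^sub>R y) \<le> (1 - t) * N x + t * N y"
    using t by (simp add: N_scaleR)
qed simp

lemma N_continuous: "continuous_on UNIV N"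
  by (rule convex_on_continuous[OF open_UNIV N_convex])

text \<open>Hahn-Banach in finite dimension: a hyperplane separates \<open>Y\<close> from the open
  \<open>N\<close>-ball of radius \<open>N Y\<close>, and its normal vector is rescaled.\<close>

lemma N_norming_functional:
  "\<exists>a. inner a Y = N Y \<and> (\<forall>X. inner a X \<le> N X)"
proof (cases "Y = 0")
  case True
  then show ?thesis by (intro exI[of _ 0]) (simp add: N_zero N_nonneg)
next
  case False
  then have NY: "N Y > 0" using N_nonneg[of Y] N_eq_0[of Y] by linarith
  let ?S = "{X. N X < N Y}"
  have "convex ?S"
  proof (rule convexI)
    fix x y and u v :: real
    assume "x \<in> ?S" "y \<in> ?S" and uv: "0 \<le> u" "0 \<le> v" "u + v = 1"
    have "N (u *\<^sub>R x + v *\<^sub>R y) \<le> u * N x + v * N y"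
      using N_triangle[of "u *\<^sub>R x" "v *\<^sub>R y"] uv by (simp add: N_scaleR)
    also have "\<dots> < N Y"
      using convex_bound_lt \<open>x \<in> ?S\<close> \<open>y \<in> ?S\<close> uv by blast
    finally show "u *\<^sub>R x + v *\<^sub>R y \<in> ?S" by simp
  qed
  moreover have "0 \<in> ?S" using NY by (simp add: N_zero)
  then have "?S \<noteq> {}" by blast
  ultimately obtain a b where a: "a \<noteq> 0" "\<And>X. N X < N Y \<Longrightarrow> inner a X \<le> b" "b \<le> inner a Y"
    using separating_hyperplane_sets[of ?S "{Y}"] by auto
  define k where "k = inner a Y"
  have k: "inner a X \<le> k" if "N X < N Y" for X using a(2)[OF that] a(3) by (simp add: k_def)
  \<comment> \<open>A small positive multiple of \<open>a\<close> lies in the ball and pairs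
    positively with \<open>a\<close>, so the level \<open>k\<close> is positive and may be divided
    by.\<close>
  have "N a > 0" using a N_nonneg[of a] N_eq_0[of a] by linarith
  then have "inner a ((N Y / (2 * N a)) *\<^sub>R a) \<le> k"
    using NY by (intro k) (simp add: N_scaleR)
  moreover have "inner a ((N Y / (2 * N a)) *\<^sub>R a) > 0" using NY \<open>N a > 0\<close> a(1) by simp
  ultimately have kpos: "k > 0" by linarith
  have le: "inner a X * N Y \<le> k * N X" for X
  proof (cases "X = 0")
    case False
    then have NX: "N X > 0" using N_nonneg[of X] N_eq_0[of X] by linarith
    \<comment> \<open>For s < 1 the rescaled point is strictly inside the ball; the boundary value
      follows by letting \<open>s\<close> tend to 1.\<close>
    have "s * (inner a X * N Y) \<le> k * N X" if s: "0 < s" "s < 1" for s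
    proof -
      have "inner a ((s * N Y / N X) *\<^sub>R X) \<le> k"
        using NX NY s by (intro k) (simp add: N_scaleR)
      then show ?thesis using NX by (simp add: field_simps)
    qed
    then show ?thesis by (rule field_le_mult_one_interval)
  qed (simp add: N_zero)
  show ?thesis
  proof (intro exI[of _ "(N Y / k) *\<^sub>R a"] conjI allI)
    show "inner ((N Y / k) *\<^sub>R a) Y = N Y" using kpos by (simp add: k_def)
    show "inner ((N Y / k) *\<^sub>R a) X \<le> N X" for X
      using le[of X] kpos by (simp add: field_simps)
  qed
qed

end

subsection \<open>Positive definite matrices, square roots and logarithms\<close>

definition pd :: "complex^'n^'n \<Rightarrow> bool"
  where "pd A \<longleftrightarrow> mstar A = A \<and> (\<forall>x. x \<noteq> 0 \<longrightarrow> inner x (A *v x) > 0)"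

lemma invertible_vec_nonzero:
  fixes A :: "complex^'n^'n"
  assumes "invertible A" "x \<noteq> 0"
  shows "A *v x \<noteq> 0"
proof
  assume "A *v x = 0"
  then have "matrix_inv A *v (A *v x) = 0" by simp
  then show False using assms by (simp add: matrix_vector_mul_assoc invertible_matrix_inv)
qed

lemma unitary_invertible: "unitary_mat U \<Longrightarrow> invertible U"
  by (auto simp: unitary_mat_def invertible_def)

lemma inner_vec_dmat: "inner x (dmat (\<lambda>i. of_real (d i)) *v x) = (\<Sum>i\<in>UNIV. d i * (cmod (x $ i))\<^sup>2)"
  by (simp add: inner_vec_def dmat_mult_vec inner_complex_def cmod_power2)
    (simp add: power2_eq_square algebra_simps)

lemma pd_dmat:
  fixes d :: "'n::finite \<Rightarrow> real"
  assumes "\<And>i. d i > 0"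
  shows "pd (dmat (\<lambda>i. of_real (d i)))"
  unfolding pd_def
proof (intro conjI allI impI)
  fix x :: "complex^'n" assume "x \<noteq> 0"
  then obtain i where "x $ i \<noteq> 0" by (auto simp: vec_eq_iff)
  then show "inner x (dmat (\<lambda>i. of_real (d i)) *v x) > 0"
    unfolding inner_vec_dmat using assms
    by (intro sum_pos2[of UNIV i]) (auto simp: less_imp_le)
qed (simp add: mstar_dmat)

lemma pd_congruence:
  fixes A C :: "complex^'n^'n"
  assumes "pd A" "invertible C"
  shows "pd (mstar C ** A ** C)"
  unfolding pd_def
proof (intro conjI allI impI)
  show "mstar (mstar C ** A ** C) = mstar C ** A ** C"
    using assms by (simp add: mstar_mult pd_def matrix_mul_assoc)
  fix x :: "complex^'n" assume "x \<noteq> 0"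
  then have "C *v x \<noteq> 0" using assms invertible_vec_nonzero by blast
  moreover have "inner x ((mstar C ** A ** C) *v x) = inner (C *v x) (A *v (C *v x))"
    by (simp add: inner_mstar matrix_vector_mul_assoc matrix_mul_assoc)
  ultimately show "inner x ((mstar C ** A ** C) *v x) > 0" using assms by (simp add: pd_def)
qed

lemma pd_one: "pd (mat 1)"
  by (simp add: pd_def)

lemma pd_mstar_mult_self: "invertible C \<Longrightarrow> pd (mstar C ** C)"
  for C :: "complex^'n^'n"
  using pd_congruence[OF pd_one, of C] by simp

lemma pd_unitary_dmat:
  assumes "unitary_mat U" "\<And>i. d i > 0"
  shows "pd (U ** dmat (\<lambda>i. of_real (d i)) ** mstar U)"
  using pd_congruence[OF pd_dmat[of d] unitary_invertible[OF unitary_mstar[OF assms(1)]]] assms(2) by simp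

lemma pd_hermitian: "pd A \<Longrightarrow> mstar A = A"
  by (simp add: pd_def)

lemma is_eigenvalue_unitary_dmat:
  assumes "unitary_mat U"
  shows "\<exists>v. v \<noteq> 0 \<and> (U ** dmat d ** mstar U) *v v = d i *s v"
proof (intro exI conjI)
  show "U *v axis i 1 \<noteq> 0"
    using invertible_vec_nonzero[OF unitary_invertible[OF assms]] by (simp add: axis_eq_0_iff)
  have "dmat d *v axis i 1 = d i *s axis i 1"
    by (auto simp: dmat_mult_vec vec_eq_iff axis_def)
  moreover have "(U ** dmat d ** mstar U) *v (U *v axis i 1) = U *v (dmat d *v axis i 1)"
    using assms by (simp add: matrix_vector_mul_assoc unitaryD)
  moreover have "U *v (d i *s axis i 1) = d i *s (U *v axis i 1)"
    by (simp add: vec_eq_iff matrix_vector_mult_def sum_distrib_left mult_ac)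
  ultimately show "(U ** dmat d ** mstar U) *v (U *v axis i 1) = d i *s (U *v axis i 1)"
    by simp
qed

lemma pd_eigenvalue:
  assumes "pd A" "is_eigenvalue A c"
  shows "c \<in> \<real>" "Re c > 0"
proof -
  obtain v where v: "v \<noteq> 0" "A *v v = c *s v" using assms(2) by (auto simp: is_eigenvalue_def)
  have h: "hinner v (A *v v) = c * of_real ((norm v)\<^sup>2)" by (simp add: v hinner_scale hinner_self)
  have "Re c * (norm v)\<^sup>2 > 0"
    using assms(1) v inner_eq_hinner[of v "A *v v"] unfolding pd_def h by force
  then show "Re c > 0" using v by (simp add: zero_less_mult_iff)
  have "cnj (hinner v (A *v v)) = hinner v (A *v v)"
    using hinner_mstar[of A v v] pd_hermitian[OF assms(1)] by (simp add: cnj_hinner)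
  then have "cnj c = c" using v unfolding h by simp
  then show "c \<in> \<real>" by (simp add: Reals_cnj_iff)
qed

lemma pd_diagonalization:
  assumes "pd A"
  obtains U d where "unitary_mat U" "\<And>i. d i > (0::real)" "A = U ** dmat (\<lambda>i. of_real (d i)) ** mstar U"
proof -
  obtain U d where U: "unitary_mat U" and A: "A = U ** dmat (\<lambda>i. of_real (d i)) ** mstar U"
    using hermitian_diagonalization[OF pd_hermitian[OF assms]] by metis
  have "is_eigenvalue A (of_real (d i))" for i
    unfolding is_eigenvalue_def A using is_eigenvalue_unitary_dmat[OF U] .
  then have "d i > 0" for i using pd_eigenvalue[OF assms] by force
  then show ?thesis using that U A by blast
qed

lemma unitary_dmat_mult:
  assumes "unitary_mat U"
  shows "(U ** dmat a ** mstar U) ** (U ** dmat b ** mstar U) = U ** dmat (\<lambda>i. a i * b i) ** mstar U"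
  by (simp add: matrix_mul_assoc unitaryD[OF assms]) (simp add: dmat_mult flip: matrix_mul_assoc)

lemma pd_unitary_dmat_inverse:
  assumes "unitary_mat U" "\<And>i. d i \<noteq> 0"
  shows "matrix_inv (U ** dmat d ** mstar U) = U ** dmat (\<lambda>i. inverse (d i)) ** mstar U"
    "invertible (U ** dmat d ** mstar U)"
proof -
  have "(U ** dmat d ** mstar U) ** (U ** dmat (\<lambda>i. inverse (d i)) ** mstar U) = mat 1"
    using assms by (simp add: unitary_dmat_mult dmat_one unitaryD)
  then show "matrix_inv (U ** dmat d ** mstar U) = U ** dmat (\<lambda>i. inverse (d i)) ** mstar U"
    "invertible (U ** dmat d ** mstar U)" by (rule matrix_inv_eqI)+
qed

lemma pd_invertible:
  assumes "pd A" shows "invertible A"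
proof -
  obtain U d where U: "unitary_mat U" and d: "\<And>i. d i > (0::real)"
    and A: "A = U ** dmat (\<lambda>i. of_real (d i)) ** mstar U"
    using pd_diagonalization[OF assms] by metis
  have "complex_of_real (d i) \<noteq> 0" for i using d[of i] by simp
  then show ?thesis unfolding A by (intro pd_unitary_dmat_inverse U)
qed

lemma pd_inv:
  assumes "pd A" shows "pd (matrix_inv A)"
proof -
  obtain U d where U: "unitary_mat U" and d: "\<And>i. d i > (0::real)"
    and A: "A = U ** dmat (\<lambda>i. of_real (d i)) ** mstar U"
    using pd_diagonalization[OF assms] by metis
  have "complex_of_real (d i) \<noteq> 0" for i using d[of i] by simp
  then have "matrix_inv A = U ** dmat (\<lambda>i. of_real (inverse (d i))) ** mstar U"
    unfolding A by (simp add: pd_unitary_dmat_inverse U)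
  then show ?thesis using U d by (simp only: pd_unitary_dmat positive_imp_inverse_positive)
qed

lemma pd_mconj:
  assumes "pd A" shows "pd (mconj A)"
proof -
  obtain U d where U: "unitary_mat U" and d: "\<And>i. d i > (0::real)"
    and A: "A = U ** dmat (\<lambda>i. of_real (d i)) ** mstar U"
    using pd_diagonalization[OF assms] by metis
  have "mconj A = mconj U ** dmat (\<lambda>i. of_real (d i)) ** mstar (mconj U)"
    by (simp add: A mconj_mult mconj_dmat mstar_mconj)
  then show ?thesis using U d by (simp only: pd_unitary_dmat unitary_mconj)
qed

text \<open>The spectrum lies between 1 / op_norm (A^-1) and op_norm A, and both ends are attained.
  Attainment later gives eigenvalues of the matrix \<open>B\<close> that are known exactly.\<close>

lemma pd_op_norms:
  assumes "pd A"
  obtains U d where "unitary_mat U" "\<And>i. d i > (0::real)" "A = U ** dmat (\<lambda>i. of_real (d i)) ** mstar U"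
    "\<And>i. d i \<le> op_norm A" "\<And>i. 1 / op_norm (matrix_inv A) \<le> d i"
    "op_norm A > 0" "op_norm (matrix_inv A) > 0" "1 / op_norm (matrix_inv A) \<le> op_norm A"
    "\<exists>i. d i = op_norm A" "\<exists>i. d i = 1 / op_norm (matrix_inv A)"
proof -
  obtain U d where U: "unitary_mat U" and d: "\<And>i. d i > (0::real)"
    and A: "A = U ** dmat (\<lambda>i. of_real (d i)) ** mstar U"
    using pd_diagonalization[OF assms] by metis
  have opA: "op_norm (U ** dmat a ** mstar U) = op_norm (dmat a)" for a
    by (simp add: op_norm_unitary_mult U unitary_mstar)
  have d0: "complex_of_real (d i) \<noteq> 0" for i using d[of i] by simp
  have inv: "matrix_inv A = U ** dmat (\<lambda>i. of_real (inverse (d i))) ** mstar U"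
    unfolding A using d0 by (simp add: pd_unitary_dmat_inverse U)
  have op: "op_norm A = Max (range a)" if a: "\<And>i. a i > 0" "A = U ** dmat (\<lambda>i. complex_of_real (a i)) ** mstar U"
    for A a
  proof (rule antisym)
    have "a i \<le> Max (range a)" for i by simp
    then show "op_norm A \<le> Max (range a)"
      unfolding a(2) opA using a(1) by (intro op_norm_dmat_le) (auto simp: less_imp_le Max_ge_iff)
    have "a i \<le> op_norm A" for i
      using op_norm_dmat_ge[of "\<lambda>i. complex_of_real (a i)" i] a(1)[of i] unfolding a(2) opA by simp
    then show "Max (range a) \<le> op_norm A" by auto
  qed
  have o1: "op_norm A = Max (range d)" using op[of d A] d A by blast
  have o2: "op_norm (matrix_inv A) = Max (range (\<lambda>i. inverse (d i)))"
    using op[of "\<lambda>i. inverse (d i)" "matrix_inv A"] d inv by simp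
  have "op_norm A \<in> range d" unfolding o1 by (rule Max_in) auto
  moreover have "op_norm (matrix_inv A) \<in> range (\<lambda>i. inverse (d i))" unfolding o2 by (rule Max_in) auto
  ultimately obtain i j where i: "op_norm A = d i" and j: "op_norm (matrix_inv A) = inverse (d j)" by blast
  have le1: "d k \<le> op_norm A" for k unfolding o1 by simp
  have le2: "inverse (d k) \<le> op_norm (matrix_inv A)" for k unfolding o2 by simp
  have le3: "1 / op_norm (matrix_inv A) \<le> d k" for k
    using le2[of k] d[of k] d[of j] unfolding j by (simp add: field_simps)
  show ?thesis
    by (rule that[OF U d A le1 le3]) (use le1[of j] i j d in \<open>auto simp: field_simps\<close>)
qed

lemma pd_centered:
  assumes "pd A"
  defines "a \<equiv> 1 / op_norm (matrix_inv A)" and "b \<equiv> op_norm A"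
  shows "op_norm (A - ((a + b) / 2) *\<^sub>R mat 1) \<le> (b - a) / 2" "0 < a" "a \<le> b"
proof -
  obtain U d where U: "unitary_mat U" and A: "A = U ** dmat (\<lambda>i. of_real (d i)) ** mstar U"
    and d: "\<And>i. d i \<le> b" "\<And>i. a \<le> d i" and ab: "b > 0" "0 < a" "a \<le> b"
    using pd_op_norms[OF assms(1)] unfolding a_def b_def by (metis divide_pos_pos zero_less_one)
  show "0 < a" "a \<le> b" by fact+
  have "dmat (\<lambda>i. of_real (d i - (a + b) / 2)) = dmat (\<lambda>i. of_real (d i)) - ((a + b) / 2) *\<^sub>R mat 1"
    by (simp add: dmat_diff dmat_scaleR flip: dmat_one)
  then have "A - ((a + b) / 2) *\<^sub>R mat 1 = U ** dmat (\<lambda>i. of_real (d i - (a + b) / 2)) ** mstar U"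
    using U by (simp add: A matrix_distribs unitaryD)
  then have "op_norm (A - ((a + b) / 2) *\<^sub>R mat 1) = op_norm (dmat (\<lambda>i. complex_of_real (d i - (a + b) / 2)))"
    by (simp only: op_norm_unitary_mult U unitary_mstar)
  also have "\<dots> \<le> (b - a) / 2"
  proof (rule op_norm_dmat_le)
    show "cmod (complex_of_real (d i - (a + b) / 2)) \<le> (b - a) / 2" for i
      unfolding norm_of_real using d[of i] by (simp add: abs_le_iff field_simps)
  qed (use ab in simp)
  finally show "op_norm (A - ((a + b) / 2) *\<^sub>R mat 1) \<le> (b - a) / 2" .
qed

context ui_norm
begin

text \<open>Subtracting the midpoints of the spectral intervals from \<open>S\<close> and \<open>T\<close> leaves matrices
  whose norms are half the lengths of these intervals.\<close>
lemma N_sylvester_pd: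
  assumes "pd S" "pd T"
  shows "(1 / op_norm (matrix_inv S) + 1 / op_norm (matrix_inv T)) * N Y \<le> N (S ** Y + Y ** T)"
proof -
  define a b a' b' where "a = 1 / op_norm (matrix_inv S)" and "b = op_norm S"
    and "a' = 1 / op_norm (matrix_inv T)" and "b' = op_norm T"
  define m m' where "m = (a + b) / 2" and "m' = (a' + b') / 2"
  have S: "op_norm (S - m *\<^sub>R mat 1) \<le> (b - a) / 2" and T: "op_norm (T - m' *\<^sub>R mat 1) \<le> (b' - a') / 2"
    unfolding m_def m'_def a_def b_def a'_def b'_def using pd_centered assms by blast+
  have pos: "0 < a" "a \<le> b" "0 < a'" "a' \<le> b'"
    unfolding a_def b_def a'_def b'_def using pd_centered assms by blast+
  have "(m + m') *\<^sub>R Y = (S ** Y + Y ** T) - ((S - m *\<^sub>R mat 1) ** Y + Y ** (T - m' *\<^sub>R mat 1))"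
    by (simp add: matrix_distribs algebra_simps)
  then have "(m + m') * N Y = N ((S ** Y + Y ** T) - ((S - m *\<^sub>R mat 1) ** Y + Y ** (T - m' *\<^sub>R mat 1)))"
    using pos N_scaleR[of "m + m'" Y] by (simp add: m_def m'_def)
  also have "\<dots> \<le> N (S ** Y + Y ** T) + (N ((S - m *\<^sub>R mat 1) ** Y) + N (Y ** (T - m' *\<^sub>R mat 1)))"
    by (rule order_trans[OF N_diff]) (intro add_left_mono N_triangle)
  also have "N ((S - m *\<^sub>R mat 1) ** Y) \<le> (b - a) / 2 * N Y"
    by (rule order_trans[OF N_mult_left]) (intro mult_right_mono S N_nonneg)
  also have "N (Y ** (T - m' *\<^sub>R mat 1)) \<le> (b' - a') / 2 * N Y"
    by (rule order_trans[OF N_mult_right]) (intro mult_right_mono T N_nonneg)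
  finally show ?thesis
    unfolding a_def[symmetric] a'_def[symmetric] by (simp add: m_def m'_def field_simps)
qed

text \<open>A commutator does not see multiples of the identity, so \<open>S\<close> may be replaced
  by its deviation from the midpoint of its spectral interval. The factor becomes the length of that
  interval in place of 2 op_norm S.\<close>

lemma N_commutator_pd:
  assumes "pd S"
  shows "N (S ** Y - Y ** S) \<le> (op_norm S - 1 / op_norm (matrix_inv S)) * N Y"
proof -
  define a b where "a = 1 / op_norm (matrix_inv S)" and "b = op_norm S"
  define m where "m = (a + b) / 2"
  have S: "op_norm (S - m *\<^sub>R mat 1) \<le> (b - a) / 2"
    unfolding m_def a_def b_def using pd_centered assms by blast
  have "S ** Y - Y ** S = (S - m *\<^sub>R mat 1) ** Y - Y ** (S - m *\<^sub>R mat 1)"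
    by (simp add: matrix_distribs)
  then have "N (S ** Y - Y ** S) \<le> N ((S - m *\<^sub>R mat 1) ** Y) + N (Y ** (S - m *\<^sub>R mat 1))"
    using N_diff by simp
  also have "\<dots> \<le> (b - a) / 2 * N Y + (b - a) / 2 * N Y"
    by (intro add_mono order_trans[OF N_mult_left] order_trans[OF N_mult_right] mult_right_mono S N_nonneg)
  finally show ?thesis unfolding a_def[symmetric] b_def[symmetric] by (simp add: field_simps)
qed

end

section \<open>Square roots with positive spectrum\<close>

text \<open>The vector (B - m) v is annihilated by B + m; were it nonzero, -m would be an eigenvalue
  of \<open>B\<close>.\<close>

lemma eigenvector_square_root:
  assumes "B ** B = A" "A *v v = of_real (m * m) *s v" "m > 0"
    "\<And>c. is_eigenvalue B c \<Longrightarrow> Re c > 0"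
  shows "B *v v = of_real m *s v"
proof (rule ccontr)
  assume ne: "B *v v \<noteq> of_real m *s v"
  define u where "u = B *v v - of_real m *s v"
  have scale: "B *v (c *s x) = c *s (B *v x)" for c x
    by (simp add: vec_eq_iff matrix_vector_mult_def sum_distrib_left mult_ac)
  have "B *v (B *v v) = of_real (m * m) *s v"
    using assms(1,2) by (simp add: matrix_vector_mul_assoc)
  then have "B *v u = of_real (m * m) *s v - of_real m *s (B *v v)"
    by (simp add: u_def matrix_vector_mult_diff_distrib scale)
  also have "\<dots> = (- of_real m) *s u"
    by (simp add: u_def vec_eq_iff algebra_simps)
  finally have "B *v u = (- of_real m) *s u" .
  moreover have "u \<noteq> 0" using ne by (simp add: u_def)
  ultimately have "is_eigenvalue B (- of_real m)" unfolding is_eigenvalue_def by blast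
  then show False using assms(3) assms(4)[of "- of_real m"] by simp
qed

text \<open>The columns of \<open>Q\<close> are eigenvectors of \<open>A\<close> and hence of
  \<open>B\<close>, so \<open>B\<close> is diagonalised by the same \<open>Q\<close>.
  Diagonalisability of \<open>B\<close> is a conclusion here: \<open>mat_sqrt\<close> asks for
  uniqueness among all matrices with positive eigenvalues.\<close>

lemma square_root_unique:
  fixes Q Qi :: "complex^'n^'n"
  assumes Q: "Q ** Qi = mat 1" and m: "\<And>i. m i > (0::real)"
    and "B ** B = A" "\<And>c. is_eigenvalue B c \<Longrightarrow> Re c > 0"
    and A: "A = Q ** dmat (\<lambda>i. of_real (m i * m i)) ** Qi"
  shows "B = Q ** dmat (\<lambda>i. of_real (m i)) ** Qi"
proof -
  have Q': "Qi ** Q = mat 1" using Q matrix_inv_eqI(3) by blast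
  have "A ** Q = Q ** dmat (\<lambda>i. of_real (m i * m i))"
    using Q' by (simp add: A matrix_mul_assoc[symmetric])
  then have "(A *v column j Q) $ k = (of_real (m j * m j) *s column j Q) $ k" for j k
    using matrix_mult_column[of A Q k j] by (simp add: mult_dmat_nth column_def mult.commute)
  then have "A *v column j Q = of_real (m j * m j) *s column j Q" for j by (simp add: vec_eq_iff)
  then have "B *v column j Q = of_real (m j) *s column j Q" for j
    using eigenvector_square_root assms by blast
  then have "B ** Q = Q ** dmat (\<lambda>i. of_real (m i))"
    unfolding vec_eq_iff matrix_mult_column[of B] mult_dmat_nth by (simp add: column_def mult.commute)
  then show ?thesis using Q by (metis matrix_mul_assoc matrix_mul_rid)
qed

lemma similar_eigenvalue:
  fixes Q Qi :: "complex^'n^'n"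
  assumes Q: "Q ** Qi = mat 1" and ev: "is_eigenvalue (Q ** A ** Qi) c"
  shows "is_eigenvalue A c"
proof -
  have Q': "Qi ** Q = mat 1" using Q matrix_inv_eqI(3) by blast
  obtain v where v: "v \<noteq> 0" "(Q ** A ** Qi) *v v = c *s v" using ev by (auto simp: is_eigenvalue_def)
  have scale: "Qi *v (c *s x) = c *s (Qi *v x)" for c x
    by (simp add: vec_eq_iff matrix_vector_mult_def sum_distrib_left mult_ac)
  have "invertible Qi" using Q Q' by (auto simp: invertible_def)
  then have "Qi *v v \<noteq> 0" using v invertible_vec_nonzero by blast
  moreover have "A *v (Qi *v v) = Qi *v ((Q ** A ** Qi) *v v)"
    using Q' by (simp add: matrix_vector_mul_assoc matrix_mul_assoc)
  then have "A *v (Qi *v v) = c *s (Qi *v v)" using v by (simp add: scale)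
  ultimately show ?thesis by (auto simp: is_eigenvalue_def)
qed

text \<open>Conjugation by P2 brings the matrix under the root in \<beta>(Z) into this form, the
  square of a positive definite matrix up to similarity.\<close>

lemma mat_sqrt_eqI:
  fixes Q Qi :: "complex^'n^'n"
  assumes "pd P" and Q: "Q ** Qi = mat 1" and A: "A = Q ** (P ** P) ** Qi"
  shows "mat_sqrt A = Q ** P ** Qi"
proof -
  have Q': "Qi ** Q = mat 1" using Q matrix_inv_eqI(3) by blast
  obtain U d where U: "unitary_mat U" and d: "\<And>i. d i > (0::real)"
    and P: "P = U ** dmat (\<lambda>i. of_real (d i)) ** mstar U"
    using pd_diagonalization[OF \<open>pd P\<close>] by metis
  have inv: "(Q ** U) ** (mstar U ** Qi) = mat 1"
    using Q unitaryD[OF U] by (metis matrix_mul_assoc matrix_mul_rid)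
  have A': "A = (Q ** U) ** dmat (\<lambda>i. of_real (d i * d i)) ** (mstar U ** Qi)"
    unfolding A P unitary_dmat_mult[OF U] by (simp add: matrix_mul_assoc)
  have P': "Q ** P ** Qi = (Q ** U) ** dmat (\<lambda>i. of_real (d i)) ** (mstar U ** Qi)"
    unfolding P by (simp add: matrix_mul_assoc)
  show ?thesis unfolding mat_sqrt_def
  proof (rule the_equality, intro conjI allI impI)
    show "(Q ** P ** Qi) ** (Q ** P ** Qi) = A"
      unfolding A using Q' by (metis matrix_mul_assoc matrix_mul_rid)
    fix c assume "is_eigenvalue (Q ** P ** Qi) c"
    then have "is_eigenvalue P c" using similar_eigenvalue Q by blast
    then show "c \<in> \<real>" "Re c > 0" using pd_eigenvalue \<open>pd P\<close> by blast+
  next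
    fix B assume "B ** B = A \<and> (\<forall>c. is_eigenvalue B c \<longrightarrow> c \<in> \<real> \<and> 0 < Re c)"
    then show "B = Q ** P ** Qi"
      unfolding P' using square_root_unique[OF inv d _ _ A'] by blast
  qed
qed

lemma pd_square_root_unique:
  assumes "pd P" "pd P'" "P' ** P' = P ** P"
  shows "P' = P"
proof -
  obtain U d where U: "unitary_mat U" and d: "\<And>i. d i > (0::real)"
    and P: "P = U ** dmat (\<lambda>i. of_real (d i)) ** mstar U"
    using pd_diagonalization[OF \<open>pd P\<close>] by metis
  have "P ** P = U ** dmat (\<lambda>i. of_real (d i * d i)) ** mstar U"
    unfolding P by (simp add: unitary_dmat_mult U)
  from square_root_unique[OF unitaryD(2)[OF U] d assms(3) _ this] show ?thesis
    using pd_eigenvalue[OF assms(2)] P by blast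
qed

lemma pd_square_root_exists:
  assumes "pd A"
  shows "\<exists>P. pd P \<and> P ** P = A"
proof -
  obtain U d where U: "unitary_mat U" and d: "\<And>i. d i > (0::real)"
    and A: "A = U ** dmat (\<lambda>i. of_real (d i)) ** mstar U"
    using pd_diagonalization[OF assms] by metis
  let ?P = "U ** dmat (\<lambda>i. of_real (sqrt (d i))) ** mstar U"
  have "pd ?P" using U d by (intro pd_unitary_dmat) auto
  moreover have "?P ** ?P = A"
    using d by (simp add: unitary_dmat_mult U A less_imp_le flip: of_real_mult)
  ultimately show ?thesis by blast
qed

definition pd_sqrt :: "complex^'n^'n \<Rightarrow> complex^'n^'n"
  where "pd_sqrt A = (SOME P. pd P \<and> P ** P = A)"

lemma pd_sqrt:
  assumes "pd A" shows "pd (pd_sqrt A)" "pd_sqrt A ** pd_sqrt A = A"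
  unfolding pd_sqrt_def using someI_ex[OF pd_square_root_exists[OF assms]] by auto

lemma pd_mult_self:
  assumes "pd P" shows "pd (P ** P)"
  using pd_mstar_mult_self[OF pd_invertible[OF assms]] pd_hermitian[OF assms] by simp

lemma pd_sqrt_mult_self:
  assumes "pd P" shows "pd_sqrt (P ** P) = P"
  using pd_square_root_unique pd_sqrt[OF pd_mult_self[OF assms]] assms by blast

section \<open>Exponentials and logarithms\<close>

lemma mat_exp_similar_dmat:
  fixes Q Qi :: "complex^'n^'n"
  assumes Q: "Qi ** Q = mat 1"
  shows "mat_exp (Q ** dmat a ** Qi) = Q ** dmat (\<lambda>i. exp (a i)) ** Qi"
proof -
  have Q': "Q ** Qi = mat 1" using Q matrix_inv_eqI(3) by blast
  have pow: "mat_pow (Q ** dmat a ** Qi) k = Q ** dmat (\<lambda>i. a i ^ k) ** Qi" for k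
  proof (induction k)
    case 0 then show ?case by (simp add: mat_pow_def dmat_one Q')
  next
    case (Suc k)
    have "mat_pow (Q ** dmat a ** Qi) (Suc k) = (Q ** dmat a ** Qi) ** (Q ** dmat (\<lambda>i. a i ^ k) ** Qi)"
      using Suc by (simp add: mat_pow_def)
    also have "\<dots> = Q ** (dmat a ** dmat (\<lambda>i. a i ^ k)) ** Qi"
      using Q by (metis matrix_mul_assoc matrix_mul_rid)
    finally show ?case by (simp add: dmat_mult)
  qed
  let ?t = "\<lambda>k. (1 / fact k) *\<^sub>R mat_pow (Q ** dmat a ** Qi) k"
  \<comment> \<open>Each entry of Q D Qi is a fixed linear combination of the diagonal of D, so
    convergence of the matrix series reduces to finitely many scalar exponential series.\<close>
  have entry: "(Q ** dmat b ** Qi) $ i $ j = (\<Sum>l\<in>UNIV. Q $ i $ l * b l * Qi $ l $ j)" for b i j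
    by (simp only: matrix_matrix_mult_def[of "Q ** dmat b"] mult_dmat_nth vec_lambda_beta)
  have "(\<lambda>k. ?t k $ i $ j) sums ((Q ** dmat (\<lambda>i. exp (a i)) ** Qi) $ i $ j)" for i j
  proof -
    have "(\<lambda>k. (1 / fact k) *\<^sub>R (a l ^ k)) sums exp (a l)" for l
      using exp_converges[of "a l"] by (simp only: inverse_eq_divide)
    then have "(\<lambda>k. \<Sum>l\<in>UNIV. Q $ i $ l * ((1 / fact k) *\<^sub>R (a l ^ k)) * Qi $ l $ j)
      sums (\<Sum>l\<in>UNIV. Q $ i $ l * exp (a l) * Qi $ l $ j)"
      by (intro sums_sum sums_mult sums_mult2)
    moreover have "?t k $ i $ j = (\<Sum>l\<in>UNIV. Q $ i $ l * ((1 / fact k) *\<^sub>R (a l ^ k)) * Qi $ l $ j)" for k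
      unfolding pow vector_scaleR_component entry scaleR_sum_right by simp
    ultimately show ?thesis unfolding entry by simp
  qed
  then have "?t sums (Q ** dmat (\<lambda>i. exp (a i)) ** Qi)"
    unfolding sums_def by (intro vec_tendstoI) (simp only: sum_component)
  then show ?thesis unfolding mat_exp_def by (rule sums_unique[symmetric])
qed

lemma mat_exp_unitary_dmat:
  "unitary_mat U \<Longrightarrow> mat_exp (U ** dmat a ** mstar U) = U ** dmat (\<lambda>i. exp (a i)) ** mstar U"
  by (simp add: mat_exp_similar_dmat unitaryD)

lemma mat_exp_hermitian:
  assumes "mstar L = L"
  shows "pd (mat_exp L)" "mat_exp L ** mat_exp (- L) = mat 1" "mconj (mat_exp L) = mat_exp (mconj L)"
proof -
  obtain U d where U: "unitary_mat U" and L: "L = U ** dmat (\<lambda>i. of_real (d i)) ** mstar U"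
    using hermitian_diagonalization[OF assms] by metis
  have E: "mat_exp L = U ** dmat (\<lambda>i. of_real (exp (d i))) ** mstar U"
    by (simp add: L mat_exp_unitary_dmat U exp_of_real)
  then show "pd (mat_exp L)" using U by (simp add: pd_unitary_dmat)
  have "dmat (\<lambda>i. - complex_of_real (d i)) = - dmat (\<lambda>i. of_real (d i))"
    by (simp add: vec_eq_iff dmat_nth)
  then have "- L = U ** dmat (\<lambda>i. - of_real (d i)) ** mstar U"
    by (simp add: L matrix_minus_left matrix_minus_right)
  then have "mat_exp (- L) = U ** dmat (\<lambda>i. exp (- of_real (d i))) ** mstar U"
    by (simp add: mat_exp_unitary_dmat U)
  then show "mat_exp L ** mat_exp (- L) = mat 1"
    using U by (simp add: E unitary_dmat_mult exp_minus_inverse dmat_one unitaryD flip: exp_of_real)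
  have "mconj L = mconj U ** dmat (\<lambda>i. of_real (d i)) ** mstar (mconj U)"
    by (simp add: L mconj_mult mconj_dmat mstar_mconj)
  then have "mat_exp (mconj L) = mconj U ** dmat (\<lambda>i. exp (of_real (d i))) ** mstar (mconj U)"
    by (simp add: mat_exp_unitary_dmat U unitary_mconj)
  then show "mconj (mat_exp L) = mat_exp (mconj L)"
    by (simp add: E mconj_mult mconj_dmat mstar_mconj exp_of_real)
qed

text \<open>Equality of the exponentials says that M = \<open>mstar U ** V\<close> intertwines the
  diagonals exp d and exp e, that is, an entry i, j of M vanishes unless exp (d i) = exp (e j). By
  injectivity of the real exponential, M then intertwines d and e.\<close>

lemma mat_exp_hermitian_inj:
  assumes "mstar L = L" "mstar L' = L'" "mat_exp L = mat_exp L'"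
  shows "L = L'"
proof -
  obtain U d where U: "unitary_mat U" and L: "L = U ** dmat (\<lambda>i. of_real (d i)) ** mstar U"
    using hermitian_diagonalization[OF assms(1)] by metis
  obtain V e where V: "unitary_mat V" and L': "L' = V ** dmat (\<lambda>i. of_real (e i)) ** mstar V"
    using hermitian_diagonalization[OF assms(2)] by metis
  define M where "M = mstar U ** V"
  have mul: "(dmat a ** M) $ i $ j = a i * M $ i $ j" for a i j
    by (simp add: matrix_matrix_mult_def dmat_nth if_distrib[where f="\<lambda>x. x * _"] cong: if_cong)
  have "U ** dmat (\<lambda>i. exp (of_real (d i))) ** mstar U = V ** dmat (\<lambda>i. exp (of_real (e i))) ** mstar V"
    using assms(3) by (simp add: L L' mat_exp_unitary_dmat U V)
  then have "mstar U ** (U ** dmat (\<lambda>i. exp (of_real (d i))) ** mstar U) ** V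
     = mstar U ** (V ** dmat (\<lambda>i. exp (of_real (e i))) ** mstar V) ** V" by simp
  then have "dmat (\<lambda>i. exp (of_real (d i))) ** M = M ** dmat (\<lambda>i. exp (of_real (e i)))"
    by (simp add: M_def matrix_mul_assoc unitaryD U V)
  then have "(dmat (\<lambda>i. exp (of_real (d i))) ** M) $ i $ j = (M ** dmat (\<lambda>i. exp (of_real (e i)))) $ i $ j" for i j
    by simp
  then have "exp (of_real (d i)) * M $ i $ j = exp (of_real (e j)) * M $ i $ j" for i j
    by (simp add: mul mult_dmat_nth mult.commute)
  then have "d i = e j \<or> M $ i $ j = 0" for i j
    by (metis exp_inj_iff exp_of_real mult_cancel_right of_real_eq_iff)
  then have "(dmat (\<lambda>i. of_real (d i)) ** M) $ i $ j = (M ** dmat (\<lambda>i. of_real (e i))) $ i $ j" for i j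
    by (metis mul mult_dmat_nth mult.commute mult_zero_left)
  then have "dmat (\<lambda>i. of_real (d i)) ** M = M ** dmat (\<lambda>i. of_real (e i))"
    by (simp add: vec_eq_iff)
  then have "U ** (dmat (\<lambda>i. of_real (d i)) ** M) ** mstar V = U ** (M ** dmat (\<lambda>i. of_real (e i))) ** mstar V"
    by simp
  then show ?thesis
    unfolding M_def L L' by (simp add: matrix_mul_assoc unitaryD U V)
qed

lemma pd_log_exists:
  assumes "pd A"
  obtains L where "mstar L = L" "mat_exp L = A"
proof -
  obtain U d where U: "unitary_mat U" and d: "\<And>i. d i > (0::real)"
    and A: "A = U ** dmat (\<lambda>i. of_real (d i)) ** mstar U"
    using pd_diagonalization[OF assms] by metis
  let ?L = "U ** dmat (\<lambda>i. of_real (ln (d i))) ** mstar U"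
  have "mstar ?L = ?L" by (simp add: mstar_mult mstar_dmat matrix_mul_assoc)
  moreover have "mat_exp ?L = A" using d by (simp add: mat_exp_unitary_dmat U A exp_of_real)
  ultimately show ?thesis using that by blast
qed

subsection \<open>The Lyapunov equation, and derivatives of square roots and inverses\<close>

lemma bounded_bilinear_matrix_mult: "bounded_bilinear ((**) :: complex^'n^'n \<Rightarrow> complex^'n^'n \<Rightarrow> complex^'n^'n)"
proof -
  have "bilinear ((**) :: complex^'n^'n \<Rightarrow> complex^'n^'n \<Rightarrow> complex^'n^'n)"
    unfolding bilinear_def by (auto intro!: linearI simp: matrix_distribs)
  then show ?thesis by (simp add: bilinear_conv_bounded_bilinear)
qed

lemma bounded_linear_mstar: "bounded_linear (mstar :: complex^'n^'n \<Rightarrow> _)"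
  unfolding linear_conv_bounded_linear[symmetric]
  by (auto intro!: linearI simp: mstar_add mstar_scaleR)

lemma bounded_linear_mconj: "bounded_linear (mconj :: complex^'n^'n \<Rightarrow> _)"
  unfolding linear_conv_bounded_linear[symmetric]
  by (auto intro!: linearI simp: mconj_add mconj_scaleR)

section \<open>The semigroup exp(-tB) and the Lyapunov estimate\<close>

lemma similar_mult:
  fixes Q Qi :: "complex^'n^'n"
  assumes "Qi ** Q = mat 1"
  shows "(Q ** X ** Qi) ** (Q ** Y ** Qi) = Q ** (X ** Y) ** Qi"
proof -
  have "Qi ** (Q ** A) = A" for A :: "complex^'n^'n" using assms by (simp add: matrix_mul_assoc)
  then show ?thesis by (simp flip: matrix_mul_assoc)
qed

lemma mat_exp_scaled_similar_dmat:
  fixes Q Qi :: "complex^'n^'n"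
  assumes Q: "Qi ** Q = mat 1" and B: "B = Q ** dmat (\<lambda>i. of_real (m i)) ** Qi"
  shows "mat_exp ((- t) *\<^sub>R B) = Q ** dmat (\<lambda>i. of_real (exp (- (m i * t)))) ** Qi"
proof -
  have "(- t) *\<^sub>R B = Q ** ((- t) *\<^sub>R dmat (\<lambda>i. of_real (m i))) ** Qi"
    by (simp only: B scaleR_matrix_left scaleR_matrix_right)
  also have "(- t) *\<^sub>R dmat (\<lambda>i. of_real (m i)) = dmat (\<lambda>i. of_real (- (m i * t)))"
    unfolding dmat_scaleR by (simp add: mult.commute)
  finally show ?thesis using Q by (simp only: mat_exp_similar_dmat exp_of_real)
qed

lemma mat_exp_scaled_has_vector_derivative:
  fixes Q Qi :: "complex^'n^'n"
  assumes Q: "Qi ** Q = mat 1" and B: "B = Q ** dmat (\<lambda>i. of_real (m i)) ** Qi"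
  shows "((\<lambda>t. mat_exp ((- t) *\<^sub>R B)) has_vector_derivative - (B ** mat_exp ((- t) *\<^sub>R B))) (at t within S)"
proof -
  note E = mat_exp_scaled_similar_dmat[OF Q B]
  \<comment> \<open>\<open>d k\<close> is the spectral projection for the k-th diagonal position. It
    makes exp(-tB) a finite sum of scalar exponentials with constant matrix coefficients, which is
    differentiated term by term.\<close>
  define d where "d k = Q ** dmat (\<lambda>i. if i = k then 1 else 0) ** Qi" for k
  have dm: "dmat (\<lambda>i. of_real (c i)) = (\<Sum>k\<in>UNIV. c k *\<^sub>R dmat (\<lambda>i. if i = k then 1 else (0::complex)))"
    for c :: "'n \<Rightarrow> real"
    by (auto simp: vec_eq_iff dmat_nth sum_component scaleR_conv_of_real[where 'a=complex]
      if_distrib[where f="\<lambda>x. _ * x"] cong: if_cong)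
  have expand: "Q ** dmat (\<lambda>i. of_real (c i)) ** Qi = (\<Sum>k\<in>UNIV. c k *\<^sub>R d k)" for c :: "'n \<Rightarrow> real"
  proof -
    interpret bounded_linear "\<lambda>X. Q ** X ** Qi"
      unfolding linear_conv_bounded_linear[symmetric] by (auto intro!: linearI simp: matrix_distribs)
    show ?thesis unfolding dm d_def sum scaleR ..
  qed
  have BE: "B ** mat_exp ((- t) *\<^sub>R B) = Q ** dmat (\<lambda>i. of_real (m i * exp (- (m i * t)))) ** Qi" for t
    unfolding E by (subst B) (simp only: similar_mult[OF Q] dmat_mult of_real_mult)
  have "((\<lambda>t. \<Sum>k\<in>UNIV. exp (- (m k * t)) *\<^sub>R d k) has_vector_derivative
     (\<Sum>k\<in>UNIV. (- (m k * exp (- (m k * t)))) *\<^sub>R d k)) (at t within S)"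
  proof (rule has_vector_derivative_sum)
    fix k
    have "((\<lambda>t. exp (- (m k * t))) has_field_derivative - (m k * exp (- (m k * t)))) (at t within S)"
      by (auto intro!: derivative_eq_intros)
    from has_vector_derivative_scaleR[OF this has_vector_derivative_const[of "d k"]]
    show "((\<lambda>t. exp (- (m k * t)) *\<^sub>R d k) has_vector_derivative (- (m k * exp (- (m k * t)))) *\<^sub>R d k) (at t within S)"
      by simp
  qed
  then show "((\<lambda>t. mat_exp ((- t) *\<^sub>R B)) has_vector_derivative - (B ** mat_exp ((- t) *\<^sub>R B))) (at t within S)"
    unfolding BE unfolding E unfolding expand by (simp only: scaleR_minus_left sum_negf)
qed

lemma op_norm_similar_dmat_ge:
  fixes Q Qi :: "complex^'n^'n"
  assumes Q: "Qi ** Q = mat 1"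
  shows "cmod (a i) \<le> op_norm (Q ** dmat a ** Qi)"
proof -
  let ?q = "Q *v axis i 1"
  have "invertible Q" using Q matrix_left_right_inverse invertible_def by blast
  then have q: "?q \<noteq> 0" using invertible_vec_nonzero[of Q "axis i 1"] by (simp add: axis_eq_0_iff)
  have "dmat a *v axis i 1 = a i *s axis i 1"
    by (auto simp: dmat_mult_vec vec_eq_iff axis_def)
  moreover have "(Q ** dmat a ** Qi) *v ?q = Q *v (dmat a *v axis i 1)"
    using Q by (simp add: matrix_vector_mul_assoc flip: matrix_mul_assoc)
  moreover have "Q *v (a i *s axis i 1) = a i *s ?q"
    by (simp add: vec_eq_iff matrix_vector_mult_def sum_distrib_left mult_ac)
  ultimately have "cmod (a i) * norm ?q \<le> op_norm (Q ** dmat a ** Qi) * norm ?q"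
    using op_norm_bound[of "Q ** dmat a ** Qi" ?q] by (simp add: norm_scale_vec)
  then show ?thesis using q by simp
qed

lemma op_norm_pd_square:
  assumes "pd P"
  shows "op_norm (P ** P) = (op_norm P)\<^sup>2"
proof (rule antisym)
  show "op_norm (P ** P) \<le> (op_norm P)\<^sup>2" using op_norm_mult[of P P] by (simp add: power2_eq_square)
  have "op_norm P \<le> sqrt (op_norm (P ** P))"
  proof (rule op_norm_leI)
    fix v
    have "(norm (P *v v))\<^sup>2 = inner v ((P ** P) *v v)"
      using pd_hermitian[OF assms] by (simp add: power2_norm_eq_inner inner_mstar matrix_vector_mul_assoc)
    also have "\<dots> \<le> norm v * (op_norm (P ** P) * norm v)"
      by (rule order_trans[OF norm_cauchy_schwarz]) (intro mult_left_mono op_norm_bound norm_ge_zero)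
    finally have "(norm (P *v v))\<^sup>2 \<le> (sqrt (op_norm (P ** P)) * norm v)\<^sup>2"
      by (simp add: power_mult_distrib op_norm_nonneg) (simp add: power2_eq_square mult_ac)
    then show "norm (P *v v) \<le> sqrt (op_norm (P ** P)) * norm v"
      by (rule power2_le_imp_le) (simp add: op_norm_nonneg)
  qed (simp add: op_norm_nonneg)
  then have "(op_norm P)\<^sup>2 \<le> (sqrt (op_norm (P ** P)))\<^sup>2" by (intro power_mono op_norm_nonneg)
  then show "(op_norm P)\<^sup>2 \<le> op_norm (P ** P)" by (simp add: op_norm_nonneg)
qed

text \<open>\<open>B\<close> is in general not normal, so its eigenvalues do not determine op_norm
  (exp(-tB)). From above the conditioning of \<open>Q\<close> enters as a constant factor, enough
  for decay and integrability; from below each single eigenvalue gives exp (- m i t), whose square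
  has integral 1 / (2 m i).\<close>

lemma op_norm_exp_integrable:
  fixes Q Qi :: "complex^'n^'n"
  assumes Q: "Qi ** Q = mat 1" and B: "B = Q ** dmat (\<lambda>i. of_real (m i)) ** Qi" and m: "\<And>i. m i > (0::real)"
  shows "continuous_on S (\<lambda>t. (op_norm (mat_exp ((- t) *\<^sub>R B)))\<^sup>2)"
    and "(\<lambda>t. (op_norm (mat_exp ((- t) *\<^sub>R B)))\<^sup>2) integrable_on {0..}"
    and "((\<lambda>t. (op_norm (mat_exp ((- t) *\<^sub>R B)))\<^sup>2) \<longlongrightarrow> 0) at_top"
    and "1 / (2 * m i) \<le> integral {0..} (\<lambda>t. (op_norm (mat_exp ((- t) *\<^sub>R B)))\<^sup>2)"
proof -
  let ?E = "\<lambda>t. mat_exp ((- t) *\<^sub>R B)"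
  note E = mat_exp_scaled_similar_dmat[OF Q B]
  have "continuous_on S ?E" for S
    by (intro continuous_on_vector_derivative[of S _ "\<lambda>t. - (B ** ?E t)"] mat_exp_scaled_has_vector_derivative[OF Q B])
  then show cont: "continuous_on S (\<lambda>t. (op_norm (?E t))\<^sup>2)" for S
    by (intro continuous_intros continuous_on_compose2[OF op_norm.N_continuous]) auto
  define \<mu> where "\<mu> = Min (range m)"
  have "\<mu> \<in> range m" unfolding \<mu>_def by (rule Min_in) auto
  then have \<mu>: "\<mu> > 0" using m by auto
  have \<mu>le: "\<mu> \<le> m i" for i unfolding \<mu>_def by simp
  define K where "K = op_norm Q * op_norm Qi"
  have bound: "(op_norm (?E t))\<^sup>2 \<le> K\<^sup>2 * exp (- (2 * \<mu>) * t)" if "t \<ge> 0" for t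
  proof -
    have "op_norm (dmat (\<lambda>i. complex_of_real (exp (- (m i * t))))) \<le> exp (- (\<mu> * t))"
      using \<mu>le that by (intro op_norm_dmat_le) (auto simp: mult_right_mono)
    then have "op_norm (?E t) \<le> op_norm Q * exp (- (\<mu> * t)) * op_norm Qi"
      unfolding E by (intro order_trans[OF op_norm.N_mult_mult] mult_right_mono mult_left_mono op_norm_nonneg)
    then have "(op_norm (?E t))\<^sup>2 \<le> (K * exp (- (\<mu> * t)))\<^sup>2"
      unfolding K_def by (intro power_mono op_norm_nonneg) (simp add: mult_ac)
    also have "\<dots> = K\<^sup>2 * exp (- (2 * \<mu>) * t)"
      by (simp add: power_mult_distrib flip: exp_double)
    finally show ?thesis .
  qed
  have int: "(\<lambda>t. K\<^sup>2 * exp (- (2 * \<mu>) * t)) integrable_on {0..}"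
    using \<mu> integrable_on_exp_minus_to_infinity[of "2 * \<mu>" 0] by (intro integrable_on_mult_right) auto
  show g: "(\<lambda>t. (op_norm (?E t))\<^sup>2) integrable_on {0..}"
    using cont[of "{0..}"] bound int
    by (intro measurable_bounded_by_integrable_imp_integrable[OF _ int])
      (auto intro!: continuous_imp_measurable_on_sets_lebesgue)
  have "((\<lambda>t. K\<^sup>2 * exp (- (2 * \<mu>) * t)) \<longlongrightarrow> K\<^sup>2 * 0) at_top"
    using \<mu> by (intro tendsto_mult tendsto_const filterlim_compose[OF exp_at_bot]
       filterlim_tendsto_neg_mult_at_bot[OF tendsto_const _ filterlim_ident]) auto
  then have u: "((\<lambda>t. K\<^sup>2 * exp (- (2 * \<mu>) * t)) \<longlongrightarrow> 0) at_top" by simp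
  show "((\<lambda>t. (op_norm (?E t))\<^sup>2) \<longlongrightarrow> 0) at_top"
    by (rule tendsto_sandwich[OF _ eventually_mono[OF eventually_ge_at_top[of 0] bound] tendsto_const u]) simp
  have lower: "exp (- (2 * m i) * t) \<le> (op_norm (?E t))\<^sup>2" for t
  proof -
    have "exp (- (m i * t)) \<le> op_norm (?E t)"
      unfolding E using op_norm_similar_dmat_ge[OF Q, of "\<lambda>i. of_real (exp (- (m i * t)))" i] by simp
    then have "(exp (- (m i * t)))\<^sup>2 \<le> (op_norm (?E t))\<^sup>2" by (intro power_mono) auto
    then show ?thesis by (simp add: mult.assoc flip: exp_double)
  qed
  have "((\<lambda>t. exp (- (2 * m i) * t)) has_integral exp (- (2 * m i) * 0) / (2 * m i)) {0..}"
    using m by (intro has_integral_exp_minus_to_infinity) simp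
  then show "1 / (2 * m i) \<le> integral {0..} (\<lambda>t. (op_norm (?E t))\<^sup>2)"
    using has_integral_le[OF _ integrable_integral[OF g] lower] by simp
qed

text \<open>With E(t) = exp(-tB), the function \<open>f\<close>, which is Y compressed by E(t),
  starts at Y, has derivative minus the same compression of R, and tends to 0. This is the formula
  for Y as an integral over R, used only up to a finite time \<open>T\<close> and only through a
  functional norming Y, so that real integrals are compared before \<open>T\<close> tends to
  infinity.\<close>

lemma (in ui_norm) N_lyapunov:
  fixes Q Qi :: "complex^'n^'n"
  assumes Q: "Qi ** Q = mat 1" and B: "B = Q ** dmat (\<lambda>i. of_real (m i)) ** Qi" and m: "\<And>i. m i > (0::real)"
    and R: "mstar B ** Y + Y ** B = R"
  shows "N Y \<le> integral {0..} (\<lambda>t. (op_norm (mat_exp ((- t) *\<^sub>R B)))\<^sup>2) * N R"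
proof -
  let ?E = "\<lambda>t. mat_exp ((- t) *\<^sub>R B)"
  let ?g = "\<lambda>t. (op_norm (?E t))\<^sup>2"
  define f where "f t = mstar (?E t) ** Y ** ?E t" for t
  have E0: "?E 0 = mat 1"
    using mat_exp_scaled_similar_dmat[OF Q B, of 0] matrix_inv_eqI(3)[OF Q] by (simp add: dmat_one)
  have f': "(f has_vector_derivative - (mstar (?E t) ** R ** ?E t)) (at t within S)" for t S
  proof -
    have dE: "(?E has_vector_derivative - (B ** ?E t)) (at t within S)"
      by (rule mat_exp_scaled_has_vector_derivative[OF Q B])
    note dE' = bounded_linear.has_vector_derivative[OF bounded_linear_mstar dE]
    note d = bounded_bilinear.has_vector_derivative[OF bounded_bilinear_matrix_mult]
    have "(f has_vector_derivative (mstar (?E t) ** Y) ** (- (B ** ?E t)) +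
       (mstar (?E t) ** 0 + mstar (- (B ** ?E t)) ** Y) ** ?E t) (at t within S)"
      unfolding f_def by (rule d[OF d[OF dE' has_vector_derivative_const] dE])
    moreover have "(mstar (?E t) ** Y) ** (- (B ** ?E t)) +
       (mstar (?E t) ** 0 + mstar (- (B ** ?E t)) ** Y) ** ?E t = - (mstar (?E t) ** R ** ?E t)"
      unfolding R[symmetric] by (simp add: mstar_minus mstar_mult matrix_distribs matrix_mul_assoc)
    ultimately show ?thesis by simp
  qed
  have Nf: "N (mstar (?E t) ** X ** ?E t) \<le> ?g t * N X" for t X
    using N_mult_mult[of "mstar (?E t)" X "?E t"]
    by (simp add: op_norm.N_mstar power2_eq_square mult_ac)
  obtain a where "inner a Y = N Y \<and> (\<forall>X. inner a X \<le> N X)" using N_norming_functional ..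
  then have a: "inner a Y = N Y" "inner a X \<le> N X" for X by auto
  have aN: "inner a (mstar (?E t) ** X ** ?E t) \<le> ?g t * N X" for t X
    by (rule order_trans[OF a(2) Nf])
  have step: "N Y \<le> integral {0..} ?g * N R + ?g T * N Y" if "T \<ge> 0" for T
  proof -
    have "((\<lambda>t. inner a (- (mstar (?E t) ** R ** ?E t))) has_integral inner a (f T) - inner a (f 0)) {0..T}"
      by (intro fundamental_theorem_of_calculus that bounded_linear.has_vector_derivative[OF bounded_linear_inner_right] f')
    from has_integral_neg[OF this]
    have "((\<lambda>t. inner a (mstar (?E t) ** R ** ?E t)) has_integral inner a (f 0) - inner a (f T)) {0..T}"
      by simp
    moreover have gT: "?g integrable_on {0..T}"
      by (intro integrable_continuous_interval op_norm_exp_integrable(1)[OF Q B m])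
    then have "((\<lambda>t. ?g t * N R) has_integral integral {0..T} ?g * N R) {0..T}"
      by (intro has_integral_mult_left integrable_integral)
    ultimately have "inner a (f 0) - inner a (f T) \<le> integral {0..T} ?g * N R"
      by (rule has_integral_le) (rule aN)
    moreover have "inner a (f 0) = N Y" using E0 by (simp add: f_def a(1))
    moreover have "inner a (f T) \<le> ?g T * N Y" unfolding f_def by (rule aN)
    moreover have "integral {0..T} ?g \<le> integral {0..} ?g"
      by (intro integral_subset_le gT op_norm_exp_integrable(2)[OF Q B m]) auto
    then have "integral {0..T} ?g * N R \<le> integral {0..} ?g * N R" by (intro mult_right_mono N_nonneg)
    ultimately show ?thesis by linarith
  qed
  have "((\<lambda>T. integral {0..} ?g * N R + ?g T * N Y) \<longlongrightarrow> integral {0..} ?g * N R + 0 * N Y) at_top"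
    by (intro tendsto_intros op_norm_exp_integrable(3)[OF Q B m])
  then have "N Y \<le> integral {0..} ?g * N R + 0 * N Y"
    by (rule tendsto_lowerbound[OF _ eventually_mono[OF eventually_ge_at_top[of 0] step]])
      (auto simp: trivial_limit_at_top_linorder)
  then show ?thesis by simp
qed

section \<open>Derivatives from first-order expansions with quadratic error\<close>

text \<open>The values of \<phi> lie in an inner product space so that the squared norm of its
  increment is differentiable, with derivative 0 at \<open>x\<close>; a remainder dominated by it
  has derivative 0 too.\<close>

lemma has_derivative_quadratic_remainder:
  fixes \<phi> :: "'a::real_normed_vector \<Rightarrow> 'b::real_inner" and f :: "'a \<Rightarrow> 'c::real_normed_vector"
  assumes \<phi>: "(\<phi> has_derivative \<phi>') (at x)" and L: "bounded_linear L"
    and rem: "\<forall>\<^sub>F y in at x. norm (f y - f x - L (\<phi> y - \<phi> x)) \<le> K * (norm (\<phi> y - \<phi> x))\<^sup>2"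
  shows "(f has_derivative (\<lambda>h. L (\<phi>' h))) (at x)"
proof -
  define r where "r y = f y - f x - L (\<phi> y - \<phi> x)" for y
  define s where "s y = K * inner (\<phi> y - \<phi> x) (\<phi> y - \<phi> x)" for y
  have "(s has_derivative (\<lambda>h. 0)) (at x)"
    unfolding s_def by (auto intro!: derivative_eq_intros \<phi>)
  then have s: "((\<lambda>y. (1 / norm (y - x)) *\<^sub>R s y) \<longlongrightarrow> 0) (at x)"
    unfolding has_derivative_within by (simp add: s_def)
  have rx: "r x = 0" using linear_0[OF bounded_linear.linear[OF L]] by (simp add: r_def)
  have "\<forall>\<^sub>F y in at x. norm ((1 / norm (y - x)) *\<^sub>R r y) \<le> (1 / norm (y - x)) *\<^sub>R s y"
    using rem by eventually_elim (simp add: r_def s_def divide_right_mono flip: power2_norm_eq_inner)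
  then have "((\<lambda>y. (1 / norm (y - x)) *\<^sub>R r y) \<longlongrightarrow> 0) (at x)" using s by (rule Lim_null_comparison)
  then have "(r has_derivative (\<lambda>h. 0)) (at x)"
    unfolding has_derivative_within by (simp add: rx)
  moreover have "((\<lambda>y. f x + L (\<phi> y - \<phi> x)) has_derivative (\<lambda>h. L (\<phi>' h))) (at x)"
    by (auto intro!: derivative_eq_intros bounded_linear.has_derivative[OF L] \<phi>)
  ultimately have "((\<lambda>y. f x + L (\<phi> y - \<phi> x) + r y) has_derivative (\<lambda>h. L (\<phi>' h) + 0)) (at x)"
    by (rule has_derivative_add[rotated])
  then show ?thesis by (simp add: r_def)
qed

lemma norm_matrix_mult_le:
  "\<exists>K. K > 0 \<and> (\<forall>(A :: complex^'n^'n) (B :: complex^'n^'n). norm (A ** B) \<le> norm A * norm B * K)"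
  using bounded_bilinear.pos_bounded[OF bounded_bilinear_matrix_mult] .

text \<open>The linear map E to S E + E S is injective by the Sylvester bound, and its left inverse
  \<open>g\<close> composed with the derivative of \<phi> is the derivative of the root. For an
  increment D of the root, S D + D S is the increment of \<phi> minus D^2, so the error is g (D^2)
  up to sign.\<close>

lemma pd_sqrt_has_derivative:
  fixes \<phi> :: "'a::real_normed_vector \<Rightarrow> complex^'n^'n"
  assumes \<phi>: "(\<phi> has_derivative \<phi>') (at z)" and pd: "\<forall>\<^sub>F y in nhds z. pd (\<phi> y)"
  shows "\<exists>D. ((\<lambda>y. pd_sqrt (\<phi> y)) has_derivative D) (at z)"
proof -
  define S where "S = pd_sqrt (\<phi> z)"
  have S: "pd S" "S ** S = \<phi> z" unfolding S_def using pd_sqrt eventually_nhds_x_imp_x[OF pd] by blast+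
  have Sinv: "op_norm (matrix_inv S) > 0" using pd_op_norms[OF S(1)] by metis
  define C where "C = op_norm (matrix_inv S)"
  have C: "C > 0" using Sinv by (simp add: C_def)
  have "linear (\<lambda>E. S ** E + E ** S)" by (auto intro!: linearI simp: matrix_distribs algebra_simps)
  moreover have "inj (\<lambda>E. S ** E + E ** S)"
  proof (subst linear_injective_0[OF \<open>linear _\<close>], intro allI impI)
    fix E assume "S ** E + E ** S = 0"
    then have "(1 / C + 1 / C) * norm E \<le> 0"
      using frobenius.N_sylvester_pd[OF S(1) S(1), of E] by (simp add: C_def)
    then show "E = 0" using C by (simp add: field_simps)
  qed
  ultimately have "\<exists>g. linear g \<and> g \<circ> (\<lambda>E. S ** E + E ** S) = id"
    by (rule linear_injective_left_inverse)
  then obtain g where g: "linear g" "g \<circ> (\<lambda>E. S ** E + E ** S) = id" by (elim exE conjE)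
  have gS: "g (S ** E + E ** S) = E" for E using fun_cong[OF g(2), of E] by simp
  have bl: "bounded_linear g" using g(1) by (simp add: linear_conv_bounded_linear)
  obtain K where "K > 0 \<and> (\<forall>x. norm (g x) \<le> norm x * K)"
    using bounded_linear.pos_bounded[OF bl] ..
  then have K: "K > 0" "norm (g x) \<le> norm x * K" for x by auto
  obtain K' where "K' > 0 \<and> (\<forall>(A :: complex^'n^'n) (B :: complex^'n^'n). norm (A ** B) \<le> norm A * norm B * K')"
    using norm_matrix_mult_le ..
  then have K': "K' > 0" "norm (A ** B) \<le> norm A * norm B * K'" for A B :: "complex^'n^'n" by auto
  have "norm (pd_sqrt (\<phi> y) - S - g (\<phi> y - \<phi> z)) \<le> (K * K' * C\<^sup>2) * (norm (\<phi> y - \<phi> z))\<^sup>2"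
    if "pd (\<phi> y)" for y
  proof -
    define S' where "S' = pd_sqrt (\<phi> y)"
    have S': "pd S'" "S' ** S' = \<phi> y" unfolding S'_def using pd_sqrt that by blast+
    define D where "D = S' - S"
    have "S ** D + D ** S = (\<phi> y - \<phi> z) - D ** D"
      by (simp add: D_def matrix_distribs flip: S(2) S'(2))
    then have "D = g ((\<phi> y - \<phi> z) - D ** D)" using gS[of D] by simp
    then have "D - g (\<phi> y - \<phi> z) = - g (D ** D)" using linear_diff[OF g(1)] by (metis add_diff_cancel_left' diff_conv_add_uminus)
    then have "norm (D - g (\<phi> y - \<phi> z)) \<le> norm (D ** D) * K" using K(2) by simp
    also have "\<dots> \<le> (norm D * norm D * K') * K" using K'(2) K(1) by (intro mult_right_mono) auto
    also have "\<dots> \<le> (C * norm (\<phi> y - \<phi> z)) * (C * norm (\<phi> y - \<phi> z)) * K' * K"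
    proof -
      \<comment> \<open>With the new root on one side and the old one on the other the increment of
        \<phi> appears without a quadratic term. Discarding the contribution of S' in the Sylvester
        bound gives a Lipschitz constant \<open>C\<close> that does not depend on
        \<open>y\<close>.\<close>
      have "S' ** D + D ** S = \<phi> y - \<phi> z"
        by (simp add: D_def matrix_distribs flip: S(2) S'(2))
      then have "(1 / op_norm (matrix_inv S') + 1 / C) * norm D \<le> norm (\<phi> y - \<phi> z)"
        using frobenius.N_sylvester_pd[OF S'(1) S(1), of D] by (simp add: C_def)
      moreover have "1 / C * norm D \<le> (1 / op_norm (matrix_inv S') + 1 / C) * norm D"
        by (intro mult_right_mono) (simp_all add: op_norm_nonneg)
      ultimately have "norm D \<le> C * norm (\<phi> y - \<phi> z)" using C by (simp add: field_simps)
      then show ?thesis using K(1) K'(1) C by (intro mult_right_mono mult_mono) auto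
    qed
    finally show ?thesis by (simp add: D_def S'_def power2_eq_square mult_ac)
  qed
  then have "\<forall>\<^sub>F y in at z. norm (pd_sqrt (\<phi> y) - pd_sqrt (\<phi> z) - g (\<phi> y - \<phi> z))
      \<le> (K * K' * C\<^sup>2) * (norm (\<phi> y - \<phi> z))\<^sup>2"
    using pd unfolding S_def eventually_at_filter by (auto elim: eventually_mono)
  from has_derivative_quadratic_remainder[OF \<phi> bl this] show ?thesis by blast
qed

text \<open>The perturbation takes away at most half of the lower bound norm x \<le> op_norm (Z^-1)
  * norm (Z x). What is left gives injectivity and the factor 2.\<close>

lemma matrix_inv_near:
  fixes Z :: "complex^'n^'n"
  assumes Z: "invertible Z" and small: "op_norm (matrix_inv Z) * op_norm (Z' - Z) \<le> 1 / 2"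
  shows "invertible Z'" "op_norm (matrix_inv Z') \<le> 2 * op_norm (matrix_inv Z)"
proof -
  let ?V = "matrix_inv Z"
  have lower: "norm x \<le> 2 * (op_norm ?V * norm (Z' *v x))" for x
  proof -
    have "x = ?V *v (Z' *v x) - ?V *v ((Z' - Z) *v x)"
      using Z by (simp add: matrix_vector_mult_diff_rdistrib matrix_vector_mult_diff_distrib
          matrix_vector_mul_assoc invertible_matrix_inv)
    then have "norm x \<le> norm (?V *v (Z' *v x)) + norm (?V *v ((Z' - Z) *v x))"
      using norm_triangle_ineq4 by metis
    also have "norm (?V *v (Z' *v x)) \<le> op_norm ?V * norm (Z' *v x)" by (rule op_norm_bound)
    also have "norm (?V *v ((Z' - Z) *v x)) \<le> op_norm ?V * (op_norm (Z' - Z) * norm x)"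
      by (rule order_trans[OF op_norm_bound]) (intro mult_left_mono op_norm_bound op_norm_nonneg)
    also have "\<dots> \<le> 1 / 2 * norm x"
      unfolding mult.assoc[symmetric] by (intro mult_right_mono small) simp
    finally show ?thesis by simp
  qed
  have "x = 0" if "Z' *v x = 0" for x using lower[of x] that by simp
  then obtain V where "V ** Z' = mat 1" using matrix_left_invertible_ker[of Z'] by blast
  then show inv: "invertible Z'" using matrix_left_right_inverse invertible_def by blast
  show "op_norm (matrix_inv Z') \<le> 2 * op_norm ?V"
  proof (rule op_norm_leI)
    show "norm (matrix_inv Z' *v x) \<le> 2 * op_norm ?V * norm x" for x
      using lower[of "matrix_inv Z' *v x"] inv
      by (simp add: matrix_vector_mul_assoc invertible_matrix_inv mult.assoc)
  qed (simp add: op_norm_nonneg)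
qed

lemma eventually_matrix_inv_near:
  fixes Z :: "complex^'n^'n"
  assumes "invertible Z"
  shows "\<forall>\<^sub>F Z' in nhds Z. op_norm (matrix_inv Z) * op_norm (Z' - Z) \<le> 1 / 2"
proof -
  have c: "isCont (op_norm :: complex^'n^'n \<Rightarrow> real) A" for A
    using op_norm.N_continuous[where 'a='n] by (simp add: continuous_on_eq_continuous_at)
  have "isCont (\<lambda>Z'. Z' - Z) Z" by (intro continuous_intros)
  from isCont_o2[OF this c] have "isCont (\<lambda>Z'. op_norm (matrix_inv Z) * op_norm (Z' - Z)) Z"
    by (rule continuous_mult[OF continuous_const])
  then have "((\<lambda>Z'. op_norm (matrix_inv Z) * op_norm (Z' - Z)) \<longlongrightarrow> 0) (nhds Z)"
    by (simp add: continuous_within tendsto_nhds_iff op_norm.N_zero)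
  then have "\<forall>\<^sub>F Z' in nhds Z. op_norm (matrix_inv Z) * op_norm (Z' - Z) < 1 / 2"
    by (rule order_tendstoD) simp
  then show ?thesis by (auto elim: eventually_mono)
qed

lemma eventually_invertible:
  "invertible Z \<Longrightarrow> \<forall>\<^sub>F Z' in nhds Z. invertible Z'" for Z :: "complex^'n^'n"
  using eventually_mono[OF eventually_matrix_inv_near] matrix_inv_near(1) by blast

lemma matrix_inv_has_derivative:
  fixes Z :: "complex^'n^'n"
  assumes Z: "invertible Z"
  shows "(matrix_inv has_derivative (\<lambda>h. - (matrix_inv Z ** h ** matrix_inv Z))) (at Z)"
proof -
  let ?V = "matrix_inv Z"
  define L where "L h = - (?V ** h ** ?V)" for h
  have L: "bounded_linear L"
    unfolding linear_conv_bounded_linear[symmetric] L_def by (auto intro!: linearI simp: matrix_distribs)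
  obtain K where "K > 0 \<and> (\<forall>(A :: complex^'n^'n) (B :: complex^'n^'n). norm (A ** B) \<le> norm A * norm B * K)"
    using norm_matrix_mult_le ..
  then have K: "K > 0" "norm (A ** B) \<le> norm A * norm B * K" for A B :: "complex^'n^'n" by auto
  define c where "c = op_norm ?V"
  have c: "c \<ge> 0" by (simp add: c_def op_norm_nonneg)
  have "norm (matrix_inv Z' - ?V - L (Z' - Z)) \<le> (2 * c^3 * K) * (norm (Z' - Z))\<^sup>2"
    if *: "op_norm ?V * op_norm (Z' - Z) \<le> 1 / 2" for Z'
  proof -
    let ?V' = "matrix_inv Z'"
    define D where "D = Z' - Z"
    note inv = matrix_inv_near[OF Z *]
    have i: "Z' ** ?V' = mat 1" "?V ** Z = mat 1" using Z inv(1) by (simp_all add: invertible_matrix_inv)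
    \<comment> \<open>Resolvent identity. Used a second time on its own result it writes the
      remainder as V D V D V', which is quadratic in D.\<close>
    have e: "?V ** D ** ?V' = ?V - ?V'"
      using i by (simp add: D_def matrix_distribs flip: matrix_mul_assoc)
    have "?V' - ?V - L D = ?V ** D ** (?V ** D ** ?V')"
      unfolding e L_def matrix_diff_ldistrib[of "?V ** D"] by simp
    also have "\<dots> = ?V ** (D ** ?V ** D) ** ?V'" by (simp add: matrix_mul_assoc)
    also have "norm \<dots> \<le> c * norm (D ** ?V ** D) * op_norm ?V'"
      unfolding c_def by (rule frobenius.N_mult_mult)
    also have "\<dots> \<le> c * (norm D * (c * norm D) * K) * (2 * c)"
    proof (intro mult_mono)
      have "norm (D ** (?V ** D)) \<le> norm D * norm (?V ** D) * K" by (rule K)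
      also have "\<dots> \<le> norm D * (c * norm D) * K"
        using K unfolding c_def by (intro mult_right_mono mult_left_mono frobenius.N_mult_left) auto
      finally show "norm (D ** ?V ** D) \<le> norm D * (c * norm D) * K" by (simp add: matrix_mul_assoc)
    qed (use c K inv in \<open>auto simp: op_norm_nonneg c_def\<close>)
    finally show ?thesis by (simp add: D_def power2_eq_square power3_eq_cube mult_ac)
  qed
  then have "\<forall>\<^sub>F Z' in at Z. norm (matrix_inv Z' - ?V - L (Z' - Z)) \<le> (2 * c^3 * K) * (norm (Z' - Z))\<^sup>2"
    using eventually_matrix_inv_near[OF Z] unfolding eventually_at_filter by (auto elim: eventually_mono)
  from has_derivative_quadratic_remainder[OF has_derivative_ident L this] show ?thesis by (simp add: L_def)
qed

subsection \<open>Estimates along a tangent vector\<close>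

lemma matrix_cancel_left: "A ** B = mat 1 \<Longrightarrow> A ** (B ** X) = X"
  for A B X :: "complex^'n^'n"
  by (simp add: matrix_mul_assoc)

text \<open>The decomposition freed of exponentials: e^(iK) with K real skew-symmetric ranges over
  the positive definite matrices whose conjugate is their inverse, and e^S with S real symmetric
  over the real positive definite ones.\<close>

locale mostow_factors =
  fixes Z W P1 P2 :: "complex^'n^'n"
  assumes W: "unitary_mat W" and P1: "pd P1" and P1_conj: "mconj P1 ** P1 = mat 1"
    and P2: "pd P2" and P2_real: "mconj P2 = P2" and Z: "Z = W ** P1 ** P2"
begin

abbreviation "V2 \<equiv> matrix_inv P2"
abbreviation "Pb \<equiv> mconj P1"

lemma P1_conj': "P1 ** Pb = mat 1"
  using P1_conj matrix_inv_eqI(3) by blast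

lemma P1_inv: "matrix_inv P1 = Pb"
  using matrix_inv_eqI(1)[OF P1_conj'] .

lemma P2_inv: "P2 ** V2 = mat 1" "V2 ** P2 = mat 1"
  using invertible_matrix_inv[OF pd_invertible[OF P2]] .

lemma V2_inv: "matrix_inv V2 = P2"
  using matrix_inv_eqI(1)[OF P2_inv(2)] .

lemma Pb: "pd Pb" and V2: "pd V2"
  using P1 P2 by (auto intro: pd_mconj pd_inv)

lemma V2_real: "mconj V2 = V2"
proof -
  have "P2 ** mconj V2 = mat 1"
    using arg_cong[OF P2_inv(1), of mconj] by (simp add: mconj_mult P2_real)
  then show ?thesis using matrix_inv_eqI(1) by metis
qed

lemmas hermitian = pd_hermitian[OF P1] pd_hermitian[OF P2] pd_hermitian[OF Pb] pd_hermitian[OF V2]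

lemma W_conj: "mstar (mconj W) ** mconj W = mat 1" "mconj W ** mstar (mconj W) = mat 1"
  using unitary_mconj[OF W] by (auto simp: unitary_mat_def)

lemmas cancels = P1_conj P1_conj' P2_inv unitaryD(1,2)[OF W] W_conj

lemmas matrix_cancels = cancels cancels[THEN matrix_cancel_left]

lemma Z_inv: "Z ** (V2 ** Pb ** mstar W) = mat 1"
  unfolding Z by (simp add: matrix_cancels flip: matrix_mul_assoc)

lemma matrix_inv_Z: "matrix_inv Z = V2 ** Pb ** mstar W" and invertible_Z: "invertible Z"
  using matrix_inv_eqI[OF Z_inv] by auto

lemma mstar_Z: "mstar Z = P2 ** P1 ** mstar W"
  by (simp add: Z mstar_mult hermitian matrix_mul_assoc)

lemma mconj_Z: "mconj Z = mconj W ** Pb ** P2"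
  by (simp add: Z mconj_mult P2_real)

lemma gram: "mstar Z ** Z = P2 ** (P1 ** P1) ** P2"
  by (simp add: mstar_Z) (simp add: Z matrix_cancels flip: matrix_mul_assoc)

lemma mconj_gram: "mconj (mstar Z ** Z) = P2 ** (Pb ** Pb) ** P2"
  by (simp add: gram mconj_mult P2_real)

text \<open>Similar to a positive definite matrix but in general not Hermitian; hence the
  similarities \<open>Q\<close>, \<open>Qi\<close> in place of unitary matrices in the Lyapunov
  estimate.\<close>

definition "B = V2 ** (Pb ** Pb) ** P2"

lemma mat_sqrt_gram: "mat_sqrt (matrix_inv (mstar Z ** Z) ** mconj (mstar Z ** Z)) = B"
  unfolding B_def
proof (rule mat_sqrt_eqI)
  show "pd (Pb ** Pb)" by (rule pd_mult_self[OF Pb])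
  have "(mstar Z ** Z) ** (V2 ** (Pb ** Pb) ** V2) = mat 1"
    unfolding gram by (simp add: matrix_cancels flip: matrix_mul_assoc)
  from matrix_inv_eqI(1)[OF this]
  show "matrix_inv (mstar Z ** Z) ** mconj (mstar Z ** Z) = V2 ** ((Pb ** Pb) ** (Pb ** Pb)) ** P2"
    unfolding mconj_gram by (simp add: matrix_cancels flip: matrix_mul_assoc)
qed (rule P2_inv)

lemma B_eq: "B = matrix_inv Z ** (W ** mstar (mconj W)) ** mconj Z"
  by (simp add: B_def matrix_inv_Z mconj_Z matrix_cancels flip: matrix_mul_assoc)

lemma op_norm_B: "op_norm B \<le> cond_num Z"
proof -
  have "op_norm B \<le> op_norm (matrix_inv Z) * op_norm (W ** mstar (mconj W)) * op_norm (mconj Z)"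
    unfolding B_eq by (rule op_norm.N_mult_mult)
  also have "\<dots> \<le> op_norm (matrix_inv Z) * 1 * op_norm (mconj Z)"
    by (intro mult_right_mono mult_left_mono op_norm_nonneg op_norm_unitary_le unitary_mult
        unitary_mstar unitary_mconj W)
  finally show ?thesis by (simp add: cond_num_def op_norm.N_mconj mult.commute)
qed

text \<open>A unitary matrix placed between the adjoint and the conjugate of Z makes P1 and conj P1
  meet and cancel, leaving P2^2. For the inverse of P2 the same cancellation is used with the
  inverse of Z.\<close>

lemma op_norm_P2_le: "op_norm P2 \<le> op_norm Z"
proof -
  have "P2 ** P2 = mstar Z ** (W ** mstar (mconj W)) ** mconj Z"
    by (simp add: mstar_Z mconj_Z matrix_cancels flip: matrix_mul_assoc)
  then have "op_norm (P2 ** P2) \<le> op_norm (mstar Z) * op_norm (W ** mstar (mconj W)) * op_norm (mconj Z)"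
    by (simp only: op_norm.N_mult_mult)
  also have "\<dots> \<le> op_norm (mstar Z) * 1 * op_norm (mconj Z)"
    by (intro mult_right_mono mult_left_mono op_norm_nonneg op_norm_unitary_le unitary_mult
        unitary_mstar unitary_mconj W)
  finally have "(op_norm P2)\<^sup>2 \<le> (op_norm Z)\<^sup>2"
    by (simp add: op_norm_pd_square P2 op_norm.N_mconj op_norm.N_mstar power2_eq_square)
  then show ?thesis using op_norm_nonneg power2_le_imp_le by blast
qed

lemma op_norm_V2_le: "op_norm V2 \<le> op_norm (matrix_inv Z)"
proof -
  have "V2 ** V2 = mconj (matrix_inv Z) ** (mconj W ** mstar W) ** mstar (matrix_inv Z)"
    by (simp add: matrix_inv_Z mconj_mult mstar_mult V2_real hermitian matrix_cancels
        mstar_mconj[symmetric] flip: matrix_mul_assoc)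
  then have "op_norm (V2 ** V2) \<le> op_norm (mconj (matrix_inv Z)) * op_norm (mconj W ** mstar W) * op_norm (mstar (matrix_inv Z))"
    by (simp only: op_norm.N_mult_mult)
  also have "\<dots> \<le> op_norm (mconj (matrix_inv Z)) * 1 * op_norm (mstar (matrix_inv Z))"
    by (intro mult_right_mono mult_left_mono op_norm_nonneg op_norm_unitary_le unitary_mult
        unitary_mstar unitary_mconj W)
  finally have "(op_norm V2)\<^sup>2 \<le> (op_norm (matrix_inv Z))\<^sup>2"
    by (simp add: op_norm_pd_square V2 op_norm.N_mconj op_norm.N_mstar power2_eq_square)
  then show ?thesis using op_norm_nonneg power2_le_imp_le by blast
qed

abbreviation "p \<equiv> op_norm P1"

lemma op_norm_Pb: "op_norm Pb = p"
  by (rule op_norm.N_mconj)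

lemma p_ge_1: "1 \<le> p"
proof -
  have "0 < 1 / p" and le: "1 / p \<le> p" using pd_centered(2,3)[OF P1] unfolding P1_inv op_norm_Pb .
  then have "0 < p" by simp
  with le have "1\<^sup>2 \<le> p\<^sup>2" by (simp add: divide_le_eq power2_eq_square)
  then show ?thesis by (rule power2_le_imp_le) (rule op_norm_nonneg)
qed

lemma op_norm_V2_pos: "0 < op_norm V2" "0 < op_norm P2"
proof -
  note pos = pd_centered(2,3)[OF P2]
  show "0 < op_norm V2" using pos(1) by simp
  show "0 < op_norm P2" using pos by (rule less_le_trans)
qed

text \<open>Conjugation preserves the operator norm, so P1 and its inverse both have norm p, and the
  extreme eigenvalues of conj(P1)^2 are p^2 and 1/p^2. The larger one bounds p by cond(Z), the
  smaller one bounds \<beta>(Z) from below.\<close>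

lemma B_diagonalization:
  obtains Q Qi :: "complex^'n^'n" and m :: "'n \<Rightarrow> real" where "Qi ** Q = mat 1" "B = Q ** dmat (\<lambda>i. of_real (m i)) ** Qi" "\<And>i. m i > 0"
    "\<exists>i. m i = p\<^sup>2" "\<exists>i. m i = 1 / p\<^sup>2"
proof -
  have pd: "pd (Pb ** Pb)" by (rule pd_mult_self[OF Pb])
  have "(Pb ** Pb) ** (P1 ** P1) = mat 1" by (simp add: matrix_cancels flip: matrix_mul_assoc)
  then have inv: "matrix_inv (Pb ** Pb) = P1 ** P1" by (rule matrix_inv_eqI(1))
  show ?thesis
  proof (rule pd_op_norms[OF pd], rule that)
    fix U d
    assume U: "unitary_mat U" and d: "\<And>i. d i > (0::real)"
      and M: "Pb ** Pb = U ** dmat (\<lambda>i. of_real (d i)) ** mstar U"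
      and ex: "\<exists>i. d i = op_norm (Pb ** Pb)" "\<exists>i. d i = 1 / op_norm (matrix_inv (Pb ** Pb))"
    show "(mstar U ** P2) ** (V2 ** U) = mat 1"
      using unitaryD[OF U] by (simp add: matrix_cancels flip: matrix_mul_assoc)
    show "B = (V2 ** U) ** dmat (\<lambda>i. of_real (d i)) ** (mstar U ** P2)"
      unfolding B_def M by (simp add: matrix_mul_assoc)
    show "\<exists>i. d i = p\<^sup>2" "\<exists>i. d i = 1 / p\<^sup>2"
      using ex unfolding inv by (simp_all add: op_norm_pd_square P1 Pb op_norm_Pb)
    show "d i > 0" for i by (rule d)
  qed
qed

abbreviation "c \<equiv> cond_num Z"
abbreviation "\<beta> \<equiv> mostow_beta Z"

lemma beta_eq: "\<beta> = integral {0..} (\<lambda>t. (op_norm (mat_exp ((- t) *\<^sub>R B)))\<^sup>2)"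
  unfolding mostow_beta_def mat_sqrt_gram ..

lemma beta_ge: "p\<^sup>2 / 2 \<le> \<beta>"
proof (rule B_diagonalization)
  fix Q Qi and m :: "'n \<Rightarrow> real"
  assume Q: "Qi ** Q = mat 1" and B: "B = Q ** dmat (\<lambda>i. of_real (m i)) ** Qi"
    and m: "\<And>i. m i > 0" and "\<exists>i. m i = 1 / p\<^sup>2"
  then obtain i where i: "m i = 1 / p\<^sup>2" by blast
  have "1 / (2 * m i) \<le> \<beta>" unfolding beta_eq by (rule op_norm_exp_integrable(4)[OF Q B m])
  then show ?thesis unfolding i by simp
qed

lemma p_le_c: "p \<le> c"
proof (rule B_diagonalization)
  fix Q Qi and m :: "'n \<Rightarrow> real"
  assume Q: "Qi ** Q = mat 1" and B: "B = Q ** dmat (\<lambda>i. of_real (m i)) ** Qi"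
    and m: "\<And>i. m i > 0" and "\<exists>i. m i = p\<^sup>2"
  then obtain i where i: "m i = p\<^sup>2" by blast
  have "p * 1 \<le> p * p" using p_ge_1 by (intro mult_left_mono) auto
  also have "p * p = cmod (of_real (m i))" unfolding i by (simp add: power2_eq_square norm_mult op_norm_nonneg)
  also have "\<dots> \<le> op_norm B" unfolding B by (rule op_norm_similar_dmat_ge[OF Q])
  also have "\<dots> \<le> c" by (rule op_norm_B)
  finally show ?thesis by simp
qed

lemma cond_P2_le: "op_norm V2 * op_norm P2 \<le> c"
  unfolding cond_num_def using mult_mono[OF op_norm_P2_le op_norm_V2_le op_norm_nonneg op_norm_nonneg]
  by (simp add: mult.commute)

lemma V2_Z_le: "op_norm V2 * op_norm Z \<le> c"
  unfolding cond_num_def using mult_left_mono[OF op_norm_V2_le op_norm_nonneg]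
  by (simp add: mult.commute)

text \<open>The left side is the length of the spectral interval of P2^-1; cond(P2) \<le> cond(Z)
  bounds it relative to its upper end.\<close>

lemma V2_spread: "op_norm V2 - 1 / op_norm P2 \<le> op_norm V2 * (1 - 1 / c)"
proof -
  have "c > 0" using p_ge_1 p_le_c by linarith
  then show ?thesis using cond_P2_le op_norm_V2_pos by (simp add: field_simps)
qed

end

section \<open>The scalar inequalities behind the constants\<close>

text \<open>The 2 stems from \<open>F\<close> and its adjoint, the bracket from the commutators with
  P1 and P2^-1. Equality holds at p = c = 1 and \<beta> = 1/2; in general the surplus
  \<open>K\<close> of the right side over the commutator terms must pay for one missing unit,
  through \<beta> \<ge> p^2/2.\<close>

lemma rho0_inequality:
  fixes p c \<beta> :: real
  assumes p: "1 \<le> p" and c: "1 \<le> c" and \<beta>: "p\<^sup>2 / 2 \<le> \<beta>"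
  shows "2 + (p - 1 / p + p * (1 - 1 / c)) * (\<beta> * c * (1 + c\<^sup>2)) \<le> 1 + p * (\<beta> * c * (1 + c ^ 4))"
proof -
  define e where "e = p - 1 / p + p * (1 - 1 / c)"
  define K where "K = p * (1 + c ^ 4) - e * (1 + c\<^sup>2)"
  have "1 \<le> c\<^sup>2" "c\<^sup>2 \<le> c ^ 3" "1 \<le> c ^ 4"
    using c by (auto intro: one_le_power power_increasing)
  then have "0 \<le> c ^ 4 + c ^ 3 - c\<^sup>2 - 1" by linarith
  then have "0 \<le> (c - 1) * (c ^ 4 + c ^ 3 - c\<^sup>2 - 1)" using c by (intro mult_nonneg_nonneg) auto
  moreover have "1 * 1 * 2 \<le> p * c * (1 + c\<^sup>2)" using p c \<open>1 \<le> c\<^sup>2\<close> by (intro mult_mono) auto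
  \<comment> \<open>The summand p c (1 + c^2) comes from the -1/p in \<open>e\<close>. It is at
    least 2 and is all that remains at c = 1; the other summand is a product of nonnegative
    factors.\<close>
  moreover have "K * (p\<^sup>2 * c) = p ^ 3 * ((c - 1) * (c ^ 4 + c ^ 3 - c\<^sup>2 - 1)) + p * c * (1 + c\<^sup>2)"
    using p c by (simp add: K_def e_def field_simps power2_eq_square power3_eq_cube power4_eq_xxxx)
  ultimately have K: "2 \<le> K * (p\<^sup>2 * c)" using p
    by (smt (verit) mult_nonneg_nonneg zero_le_power)
  then have "0 < K * (p\<^sup>2 * c)" by linarith
  moreover have "0 < p\<^sup>2 * c" using p c by (intro mult_pos_pos zero_less_power) linarith+
  ultimately have "0 \<le> K" using zero_less_mult_pos2 less_imp_le by blast
  then have "K * (p\<^sup>2 / 2 * c) \<le> K * (\<beta> * c)"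
    using c by (intro mult_left_mono mult_right_mono \<beta>) auto
  then have "1 \<le> K * (\<beta> * c)" using K by simp
  then show ?thesis unfolding e_def[symmetric] by (simp add: K_def algebra_simps)
qed

text \<open>The hypothesis p \<le> c enters through \<beta> c \<ge> p^3/2, which supplies the 2 p^5
  on the left, the price of multiplying by P1^2 on both sides. Again p = c = 1, \<beta> = 1/2 is a
  case of equality.\<close>

lemma rho1_inequality:
  fixes p c \<beta> :: real
  assumes p: "1 \<le> p" "p \<le> c" and \<beta>: "p\<^sup>2 / 2 \<le> \<beta>"
  shows "2 * p * (1 + p ^ 4) + (p\<^sup>2 - 1 / p\<^sup>2) * (1 - 1 / c) * (\<beta> * c * (1 + c\<^sup>2))
    \<le> 2 * p * (1 + p * (\<beta> * c * (1 + c ^ 4)))"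
proof -
  have c: "1 \<le> c" using p by linarith
  define s where "s = (1 - 1 / c) * (1 + c\<^sup>2)"
  have s0: "0 \<le> s" unfolding s_def using c by (intro mult_nonneg_nonneg) auto
  have "1 - 1 / c \<le> c - 1"
  proof -
    have "0 \<le> (c - 1)\<^sup>2 / c" using c by simp
    also have "(c - 1)\<^sup>2 / c = c - 2 + 1 / c" using c by (simp add: field_simps power2_eq_square)
    finally show ?thesis by simp
  qed
  \<comment> \<open>The generous factor 2 (c + 1) makes the bound for \<open>s\<close> collapse to 2
    c^4 - 2; then 2 (1 + c^4) - s is at least 4, its value at c = 1.\<close>
  also have "\<dots> \<le> (c - 1) * (2 * (c + 1))" using c mult_left_mono[of 1 "2 * (c + 1)" "c - 1"] by simp
  finally have "s \<le> (c - 1) * (2 * (c + 1)) * (1 + c\<^sup>2)"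
    unfolding s_def by (intro mult_right_mono) auto
  also have "\<dots> = 2 * c ^ 4 - 2" by (simp add: algebra_simps power2_eq_square power4_eq_xxxx)
  finally have s: "4 \<le> 2 * (1 + c ^ 4) - s" by simp
  have y: "p ^ 3 / 2 \<le> \<beta> * c"
  proof -
    have "0 \<le> \<beta>" using order_trans[OF _ \<beta>, of 0] by simp
    then have "p\<^sup>2 / 2 * p \<le> \<beta> * c" using p \<beta> by (intro mult_mono) auto
    then show ?thesis by (simp add: power2_eq_square power3_eq_cube)
  qed
  have "2 * p ^ 5 = p ^ 3 / 2 * (p\<^sup>2 * 4)" by (simp add: power_add[symmetric])
  also have "\<dots> \<le> \<beta> * c * (p\<^sup>2 * (2 * (1 + c ^ 4) - s))"
    using p s y by (intro mult_mono mult_left_mono) (auto intro: order_trans[OF _ y])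
  also have "\<dots> \<le> \<beta> * c * (2 * p\<^sup>2 * (1 + c ^ 4) - (p\<^sup>2 - 1 / p\<^sup>2) * s)"
  proof (rule mult_left_mono)
    show "0 \<le> \<beta> * c" using y p by (intro order_trans[OF _ y]) simp
    have "0 \<le> 1 / p\<^sup>2 * s" using s0 by simp
    then show "p\<^sup>2 * (2 * (1 + c ^ 4) - s) \<le> 2 * p\<^sup>2 * (1 + c ^ 4) - (p\<^sup>2 - 1 / p\<^sup>2) * s"
      by (simp add: algebra_simps)
  qed
  finally have "2 * p ^ 5 + (p\<^sup>2 - 1 / p\<^sup>2) * s * (\<beta> * c) \<le> 2 * p\<^sup>2 * (1 + c ^ 4) * (\<beta> * c)"
    by (simp add: algebra_simps)
  moreover have "p * p ^ 4 = p ^ 5" by (simp add: power_Suc[symmetric] del: power_Suc)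
  ultimately show ?thesis unfolding s_def
    by (simp add: distrib_left power2_eq_square mult_ac)
qed

section \<open>Equations and bounds for the derivatives of the factors\<close>

text \<open>The assumptions are the differentiated identities that define the factors. With
  \<open>d0\<close>, \<open>d1\<close>, \<open>d2\<close> fixed matrices, the estimates become pure
  algebra, separate from differentiability.\<close>

locale mostow_tangent = mostow_factors Z W P1 P2 + ui_norm N
  for Z W P1 P2 :: "complex^'n^'n" and N :: "complex^'n^'n \<Rightarrow> real" +
  fixes A d0 d1 d2 :: "complex^'n^'n"
  assumes dZ: "A = (W ** P1) ** d2 + (W ** d1 + d0 ** P1) ** P2"
    and dW: "mstar W ** d0 + mstar d0 ** W = 0"
    and d1: "mstar d1 = d1" and d1_conj: "Pb ** d1 + mconj d1 ** P1 = 0"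
    and d2: "mstar d2 = d2" and d2_real: "mconj d2 = d2"
begin

text \<open>\<open>\<Omega>\<close> is W^-1 dW, which \<open>N\<close> measures like dW itself.
  \<open>R1\<close> is the derivative of P1^2 and \<open>dH\<close> that of H; \<open>F\<close> is
  \<open>A\<close> with the outer factors W and P2 stripped off.\<close>

definition "\<Omega> = mstar W ** d0"
definition "R1 = P1 ** d1 + d1 ** P1"
definition "dH = mstar Z ** A + mstar A ** Z"
definition "F = mstar W ** A ** V2"

lemma Omega_skew: "mstar \<Omega> = - \<Omega>"
  using dW by (simp add: \<Omega>_def mstar_mult eq_neg_iff_add_eq_0 add.commute)

lemma d1_conj': "mconj d1 = - (Pb ** d1 ** Pb)"
proof -
  have "(Pb ** d1 + mconj d1 ** P1) ** Pb = 0" using d1_conj by simp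
  then have "Pb ** d1 ** Pb + mconj d1 = 0"
    by (simp add: matrix_distribs) (simp add: matrix_cancels flip: matrix_mul_assoc)
  then show ?thesis by (simp add: eq_neg_iff_add_eq_0 add.commute)
qed

text \<open>The identity conj(P1^2) = (P1^2)^-1, differentiated.\<close>

lemma R1_conj: "mconj R1 = - (Pb ** Pb ** R1 ** Pb ** Pb)"
  by (simp add: R1_def mconj_add mconj_mult d1_conj' matrix_distribs)
    (simp add: matrix_cancels flip: matrix_mul_assoc)

lemma F_eq: "F = P1 ** d2 ** V2 + d1 + \<Omega> ** P1"
  unfolding F_def \<Omega>_def unfolding dZ
  by (simp add: matrix_distribs) (simp add: matrix_cancels flip: matrix_mul_assoc)

lemma F_star: "mstar F = V2 ** d2 ** P1 + d1 - P1 ** \<Omega>"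
  by (simp add: F_eq mstar_add mstar_mult hermitian d1 d2 Omega_skew matrix_distribs matrix_mul_assoc)

lemma A_eq: "mstar W ** A = F ** P2"
  by (simp add: F_def matrix_cancels flip: matrix_mul_assoc)

lemma dH_eq: "dH = P2 ** P1 ** P1 ** d2 + d2 ** P1 ** P1 ** P2 + P2 ** R1 ** P2"
proof -
  have "mstar Z ** A = P2 ** P1 ** F ** P2"
    by (simp add: mstar_Z A_eq flip: matrix_mul_assoc)
  moreover have "mstar A ** Z = mstar (mstar Z ** A)" by (simp add: mstar_mult)
  ultimately have "dH = P2 ** P1 ** F ** P2 + P2 ** mstar F ** P1 ** P2"
    by (simp add: dH_def mstar_mult hermitian matrix_mul_assoc)
  then show ?thesis unfolding F_star unfolding F_eq R1_def
    by (simp add: matrix_distribs) (simp add: matrix_cancels flip: matrix_mul_assoc)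
qed

lemma mstar_B: "mstar B = P2 ** Pb ** Pb ** V2"
  by (simp add: B_def mstar_mult hermitian matrix_mul_assoc)

text \<open>\<open>P2 ** d2 + d2 ** P2\<close> is the derivative of X = P2^2, and B = H^-1 X, so
  this is X H^-1 X = conj H differentiated. In the computation the two occurrences of
  \<open>R1\<close> cancel, which eliminates \<open>d1\<close>.\<close>

lemma lyapunov_equation:
  "mstar B ** (P2 ** d2 + d2 ** P2) + (P2 ** d2 + d2 ** P2) ** B = mconj dH + mstar B ** dH ** B"
proof -
  have "mconj dH = P2 ** Pb ** Pb ** d2 + d2 ** Pb ** Pb ** P2 - P2 ** Pb ** Pb ** R1 ** Pb ** Pb ** P2"
    by (simp add: dH_eq mconj_add mconj_mult P2_real d2_real R1_conj matrix_distribs matrix_mul_assoc)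
  moreover have "mstar B ** dH ** B = P2 ** d2 ** B + mstar B ** d2 ** P2 + P2 ** Pb ** Pb ** R1 ** Pb ** Pb ** P2"
    unfolding dH_eq mstar_B unfolding B_def
    by (simp add: matrix_distribs) (simp add: matrix_cancels flip: matrix_mul_assoc)
  moreover have "P2 ** Pb ** Pb ** d2 = mstar B ** P2 ** d2" "d2 ** Pb ** Pb ** P2 = d2 ** P2 ** B"
    unfolding mstar_B unfolding B_def by (simp_all add: matrix_cancels flip: matrix_mul_assoc)
  ultimately show ?thesis by (simp add: matrix_distribs matrix_mul_assoc)
qed

lemma N_dH: "N dH \<le> 2 * op_norm Z * N A"
proof -
  have "N dH \<le> N (mstar Z ** A) + N (mstar A ** Z)" unfolding dH_def by (rule N_triangle)
  also have "\<dots> \<le> op_norm (mstar Z) * N A + op_norm Z * N (mstar A)"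
    by (intro add_mono N_mult_left N_mult_right)
  finally show ?thesis by (simp add: N_mstar op_norm.N_mstar)
qed

lemma beta_nonneg: "0 \<le> \<beta>" and c_ge_1: "1 \<le> c"
  using beta_ge p_ge_1 p_le_c by (auto intro: order_trans[OF _ beta_ge])

definition "x = \<beta> * c * (1 + c\<^sup>2)"

text \<open>The Lyapunov estimate bounds the derivative of P2^2; the Sylvester bound for P2 passes
  to \<open>d2\<close> at the cost of op_norm (P2^-1) / 2. The half cancels the 2 in
  \<open>N_dH\<close>, and op_norm (P2^-1) * op_norm Z is at most cond(Z).\<close>

lemma N_d2: "N d2 \<le> x * N A"
proof (rule B_diagonalization)
  fix Q Qi and m :: "'n \<Rightarrow> real"
  assume Q: "Qi ** Q = mat 1" and B: "B = Q ** dmat (\<lambda>i. of_real (m i)) ** Qi" and m: "\<And>i. m i > 0"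
  let ?n = "op_norm V2"
  have "(1 / ?n + 1 / ?n) * N d2 \<le> N (P2 ** d2 + d2 ** P2)" by (rule N_sylvester_pd[OF P2 P2])
  also have "\<dots> \<le> \<beta> * N (mconj dH + mstar B ** dH ** B)"
    unfolding beta_eq by (rule N_lyapunov[OF Q B m lyapunov_equation])
  also have "\<dots> \<le> \<beta> * ((1 + c\<^sup>2) * N dH)"
  proof (intro mult_left_mono beta_nonneg)
    have "N (mstar B ** dH ** B) \<le> op_norm B * N dH * op_norm B"
      using N_mult_mult[of "mstar B" dH B] by (simp add: op_norm.N_mstar)
    also have "\<dots> \<le> c * N dH * c"
      using c_ge_1 by (intro mult_mono op_norm_B) (auto simp: N_nonneg op_norm_nonneg)
    finally show "N (mconj dH + mstar B ** dH ** B) \<le> (1 + c\<^sup>2) * N dH"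
      using N_triangle[of "mconj dH" "mstar B ** dH ** B"] by (simp add: N_mconj power2_eq_square algebra_simps)
  qed
  also have "\<dots> \<le> \<beta> * ((1 + c\<^sup>2) * (2 * op_norm Z * N A))"
    using beta_nonneg by (intro mult_left_mono N_dH) auto
  finally have "N d2 \<le> \<beta> * ((1 + c\<^sup>2) * (?n * op_norm Z * N A))"
    using op_norm_V2_pos by (simp add: field_simps)
  also have "\<dots> \<le> \<beta> * ((1 + c\<^sup>2) * (c * N A))"
    using beta_nonneg by (intro mult_left_mono mult_right_mono V2_Z_le) (auto simp: N_nonneg)
  finally show ?thesis by (simp add: x_def mult_ac)
qed

lemma N_F: "N F \<le> op_norm V2 * N A"
  using N_mult_right[of "mstar W ** A" V2] unfolding F_def by (simp add: N_unitary_left unitary_mstar W)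

lemma N_commutator_V2: "N (V2 ** Y - Y ** V2) \<le> op_norm V2 * (1 - 1 / c) * N Y"
  using N_commutator_pd[OF V2, of Y] mult_right_mono[OF V2_spread N_nonneg[of Y]] by (simp add: V2_inv)

lemma N_d0:
  "N d0 \<le> op_norm Pb * op_norm V2 / 2 * (1 + p * \<beta> * c * (1 + c ^ 4)) * N A"
proof -
  let ?n = "op_norm V2"
  \<comment> \<open>Subtracting the adjoint of \<open>F\<close> removes \<open>d1\<close>. The rest,
    P1 d2 V2 - V2 d2 P1, is rewritten by moving d2 past P1 and then d2 P1 past V2, so that only
    commutators remain.\<close>
  have eq: "P1 ** \<Omega> + \<Omega> ** P1 = (F - mstar F) - ((P1 ** d2 - d2 ** P1) ** V2 - (V2 ** (d2 ** P1) - (d2 ** P1) ** V2))"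
    unfolding F_star unfolding F_eq by (simp add: matrix_distribs matrix_mul_assoc)
  have "(1 / p + 1 / p) * N \<Omega> \<le> N (P1 ** \<Omega> + \<Omega> ** P1)"
    using N_sylvester_pd[OF P1 P1, of \<Omega>] by (simp add: P1_inv op_norm_Pb)
  also have "\<dots> \<le> (N F + N (mstar F)) + (N ((P1 ** d2 - d2 ** P1) ** V2) + N (V2 ** (d2 ** P1) - (d2 ** P1) ** V2))"
    unfolding eq by (intro order_trans[OF N_diff] add_mono N_diff)
  also have "\<dots> \<le> (?n * N A + ?n * N A) + ((p - 1 / p) * ?n * (x * N A) + p * (?n * (1 - 1 / c)) * (x * N A))"
  proof (intro add_mono)
    show "N F \<le> ?n * N A" "N (mstar F) \<le> ?n * N A" using N_F by (simp_all add: N_mstar)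
    have "N ((P1 ** d2 - d2 ** P1) ** V2) \<le> ?n * N (P1 ** d2 - d2 ** P1)" by (rule N_mult_right)
    also have "\<dots> \<le> ?n * ((p - 1 / p) * N d2)"
      using N_commutator_pd[OF P1, of d2] by (intro mult_left_mono op_norm_nonneg) (simp add: P1_inv op_norm_Pb)
    also have "\<dots> \<le> ?n * ((p - 1 / p) * (x * N A))"
    proof (intro mult_left_mono N_d2 op_norm_nonneg)
      have "1 / p \<le> 1" using p_ge_1 by simp
      then show "0 \<le> p - 1 / p" using p_ge_1 by linarith
    qed
    finally show "N ((P1 ** d2 - d2 ** P1) ** V2) \<le> (p - 1 / p) * ?n * (x * N A)" by (simp add: mult_ac)
    have "N (V2 ** (d2 ** P1) - (d2 ** P1) ** V2) \<le> ?n * (1 - 1 / c) * N (d2 ** P1)" by (rule N_commutator_V2)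
    also have "\<dots> \<le> ?n * (1 - 1 / c) * (p * (x * N A))"
    proof (intro mult_left_mono)
      show "N (d2 ** P1) \<le> p * (x * N A)"
        by (rule order_trans[OF N_mult_right]) (intro mult_left_mono N_d2 op_norm_nonneg)
    qed (use c_ge_1 in \<open>simp add: op_norm_nonneg\<close>)
    finally show "N (V2 ** (d2 ** P1) - (d2 ** P1) ** V2) \<le> p * (?n * (1 - 1 / c)) * (x * N A)" by (simp add: mult_ac)
  qed
  also have "\<dots> = ?n * N A * (2 + (p - 1 / p + p * (1 - 1 / c)) * x)" by (simp add: algebra_simps)
  also have "\<dots> \<le> ?n * N A * (1 + p * (\<beta> * c * (1 + c ^ 4)))"
    unfolding x_def using rho0_inequality[OF p_ge_1 c_ge_1 beta_ge]
    by (intro mult_left_mono) (auto simp: N_nonneg op_norm_nonneg)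
  finally have "N \<Omega> \<le> p / 2 * (?n * N A * (1 + p * (\<beta> * c * (1 + c ^ 4))))"
    using p_ge_1 by (simp add: field_simps)
  moreover have "N \<Omega> = N d0" unfolding \<Omega>_def by (rule N_unitary_left[OF unitary_mstar[OF W]])
  ultimately show ?thesis by (simp add: op_norm_Pb mult_ac)
qed

text \<open>The Sylvester bound for P1 recovers \<open>d1\<close> from \<open>R1\<close> with the
  factor p/2; a second p comes from the bound for \<open>R1\<close>, and cond(P1) = p^2 because conj
  P1 is the inverse of P1.\<close>

lemma N_d1:
  "N d1 \<le> cond_num P1 * op_norm V2 / 2 * (1 + p * \<beta> * c * (1 + c ^ 4)) * N A"
proof -
  let ?n = "op_norm V2" and ?L = "P1 ** P1"
  \<comment> \<open>\<open>G\<close> is \<open>dH\<close> with P2 stripped from both sides.\<close>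
  define G where "G = P1 ** F + mstar F ** P1"
  define C where "C = V2 ** d2 - d2 ** V2"
  have L: "pd ?L" by (rule pd_mult_self[OF P1])
  have "?L ** (Pb ** Pb) = mat 1" by (simp add: matrix_cancels flip: matrix_mul_assoc)
  then have Linv: "matrix_inv ?L = Pb ** Pb" by (rule matrix_inv_eqI(1))
  have opL: "op_norm ?L = p\<^sup>2" "op_norm (matrix_inv ?L) = p\<^sup>2"
    unfolding Linv by (simp_all add: op_norm_pd_square P1 Pb op_norm_Pb)
  have R1: "R1 = G - ?L ** d2 ** V2 - V2 ** d2 ** ?L"
    unfolding G_def R1_def F_star unfolding F_eq by (simp add: matrix_distribs matrix_mul_assoc)
  have cR1: "mconj R1 = mconj G - Pb ** Pb ** d2 ** V2 - V2 ** d2 ** Pb ** Pb"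
    unfolding R1 by (simp add: mconj_diff mconj_mult d2_real V2_real matrix_mul_assoc)
  have "R1 = - (?L ** mconj R1 ** ?L)"
    unfolding R1_conj by (simp add: matrix_minus_left matrix_minus_right matrix_cancels flip: matrix_mul_assoc)
  \<comment> \<open>\<open>R1\<close> and minus L conj(R1) L coincide. In their sum the terms with
    \<open>d2\<close>, which are no commutators in \<open>R1\<close> alone, combine to the
    commutator of L = P1^2 with \<open>C\<close>, itself a commutator of V2 and d2.\<close>
  then have "2 *\<^sub>R R1 = R1 - ?L ** mconj R1 ** ?L" by (simp add: scaleR_2)
  also have "\<dots> = (G - ?L ** mconj G ** ?L) + (?L ** C - C ** ?L)"
    unfolding cR1 unfolding R1 C_def
    by (simp add: matrix_distribs) (simp add: matrix_cancels flip: matrix_mul_assoc)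
  finally have "2 * N R1 = N ((G - ?L ** mconj G ** ?L) + (?L ** C - C ** ?L))"
    using N_scaleR[of 2 R1] by simp
  also have "\<dots> \<le> (N G + N (?L ** mconj G ** ?L)) + N (?L ** C - C ** ?L)"
    by (intro order_trans[OF N_triangle] add_mono N_diff order_refl)
  also have "\<dots> \<le> (2 * p * ?n * N A + p ^ 4 * (2 * p * ?n * N A)) + (p\<^sup>2 - 1 / p\<^sup>2) * (?n * (1 - 1 / c) * (x * N A))"
  proof (intro add_mono)
    have "N G \<le> N (P1 ** F) + N (mstar F ** P1)" unfolding G_def by (rule N_triangle)
    also have "\<dots> \<le> p * N F + p * N (mstar F)" by (intro add_mono N_mult_left N_mult_right)
    also have "\<dots> = 2 * p * N F" by (simp add: N_mstar)
    also have "\<dots> \<le> 2 * p * (?n * N A)" using op_norm_nonneg by (intro mult_left_mono N_F) simp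
    finally show G: "N G \<le> 2 * p * ?n * N A" by (simp add: mult_ac)
    have "N (?L ** mconj G ** ?L) \<le> p\<^sup>2 * N G * p\<^sup>2"
      using N_mult_mult[of ?L "mconj G" ?L] unfolding opL N_mconj .
    also have "\<dots> = p ^ 4 * N G" by (simp add: power2_eq_square power4_eq_xxxx)
    also have "\<dots> \<le> p ^ 4 * (2 * p * ?n * N A)" by (intro mult_left_mono G) simp
    finally show "N (?L ** mconj G ** ?L) \<le> p ^ 4 * (2 * p * ?n * N A)" .
    have p2: "1 / p\<^sup>2 \<le> p\<^sup>2"
      using p_ge_1 one_le_power[OF p_ge_1, of 2] by (smt (verit) divide_le_eq_1 mult_nonneg_nonneg)
    have "N C \<le> ?n * (1 - 1 / c) * N d2" unfolding C_def by (rule N_commutator_V2)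
    also have "\<dots> \<le> ?n * (1 - 1 / c) * (x * N A)"
      using c_ge_1 by (intro mult_left_mono N_d2) (simp add: op_norm_nonneg)
    finally have C: "N C \<le> ?n * (1 - 1 / c) * (x * N A)" .
    have "N (?L ** C - C ** ?L) \<le> (p\<^sup>2 - 1 / p\<^sup>2) * N C" using N_commutator_pd[OF L, of C] unfolding opL .
    also have "\<dots> \<le> (p\<^sup>2 - 1 / p\<^sup>2) * (?n * (1 - 1 / c) * (x * N A))"
      using p2 by (intro mult_left_mono C) simp
    finally show "N (?L ** C - C ** ?L) \<le> (p\<^sup>2 - 1 / p\<^sup>2) * (?n * (1 - 1 / c) * (x * N A))" .
  qed
  also have "\<dots> = ?n * N A * (2 * p * (1 + p ^ 4) + (p\<^sup>2 - 1 / p\<^sup>2) * (1 - 1 / c) * x)"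
  proof -
    have "(2 * r * a * b + q * (2 * r * a * b)) + e * (a * f * (y * b)) = a * b * (2 * r * (1 + q) + e * f * y)"
      for a b e f q r y :: real by (simp add: algebra_simps)
    then show ?thesis .
  qed
  also have "\<dots> \<le> ?n * N A * (2 * p * (1 + p * (\<beta> * c * (1 + c ^ 4))))"
    unfolding x_def by (intro mult_left_mono rho1_inequality[OF p_ge_1 p_le_c beta_ge])
      (simp add: N_nonneg op_norm_nonneg)
  finally have R1_le: "N R1 \<le> ?n * N A * (p * (1 + p * (\<beta> * c * (1 + c ^ 4))))" by simp
  have "(1 / p + 1 / p) * N d1 \<le> N R1"
    using N_sylvester_pd[OF P1 P1, of d1] by (simp add: P1_inv op_norm_Pb R1_def)
  with R1_le have "(1 / p + 1 / p) * N d1 \<le> ?n * N A * (p * (1 + p * (\<beta> * c * (1 + c ^ 4))))" by simp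
  then have "N d1 \<le> p / 2 * (?n * N A * (p * (1 + p * (\<beta> * c * (1 + c ^ 4)))))"
    using p_ge_1 by (simp add: field_simps)
  then show ?thesis by (simp add: cond_num_def P1_inv op_norm_Pb mult_ac)
qed

lemma N_d2': "N d2 \<le> \<beta> * c * (1 + c ^ 4) * N A"
proof -
  have "c\<^sup>2 \<le> c ^ 4" using c_ge_1 by (intro power_increasing) auto
  then have "x \<le> \<beta> * c * (1 + c ^ 4)"
    unfolding x_def using beta_nonneg c_ge_1 by (intro mult_left_mono) auto
  then show ?thesis using N_d2 mult_right_mono[OF _ N_nonneg[of A]] order_trans by blast
qed

end

subsection \<open>Existence, uniqueness and differentiability of the decomposition\<close>

text \<open>From left to right, L = iK is Hermitian with conj L = -L. Conversely, uniqueness of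
  Hermitian logarithms turns conj P1 = P1^-1 and conj P2 = P2 into conj L = -L and conj M = M, so K
  and S can be read off as imaginary and real parts.\<close>

lemma mostow_decomp_iff: "mostow_decomp Z W P1 P2 \<longleftrightarrow> mostow_factors Z W P1 P2"
  for Z W P1 P2 :: "complex^'n^'n"
proof
  assume "mostow_decomp Z W P1 P2"
  then obtain K S :: "real^'n^'n" where W: "unitary_mat W" and Z: "Z = W ** P1 ** P2"
    and K: "transpose K = - K" "P1 = mat_exp (map_matrix (\<lambda>x. \<i> * complex_of_real x) K)"
    and S: "transpose S = S" "P2 = mat_exp (map_matrix complex_of_real S)"
    by (auto simp: mostow_decomp_def)
  let ?L = "map_matrix (\<lambda>x. \<i> * complex_of_real x) K"
  let ?M = "map_matrix complex_of_real S"
  have tK: "K $ j $ i = - (K $ i $ j)" for i j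
    using arg_cong[OF K(1), of "\<lambda>M. M $ i $ j"] by (simp add: transpose_def)
  have tS: "S $ j $ i = S $ i $ j" for i j
    using arg_cong[OF S(1), of "\<lambda>M. M $ i $ j"] by (simp add: transpose_def)
  have "cnj (\<i> * complex_of_real (K $ j $ i)) = \<i> * complex_of_real (K $ i $ j)" for i j
    by (subst tK) simp
  then have L: "mstar ?L = ?L" "mconj ?L = - ?L"
    by (simp_all add: vec_eq_iff)
  have M: "mstar ?M = ?M" "mconj ?M = ?M"
    by (simp_all add: vec_eq_iff) (intro allI tS)
  show "mostow_factors Z W P1 P2"
  proof
    show "pd P1" "pd P2" unfolding K S using L M by (auto intro: mat_exp_hermitian)
    have "P1 ** mconj P1 = mat 1"
      using mat_exp_hermitian(2,3)[OF L(1)] unfolding L(2) K(2) by simp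
    then show "mconj P1 ** P1 = mat 1" by (rule matrix_inv_eqI(3))
    show "mconj P2 = P2" using mat_exp_hermitian(3)[OF M(1)] unfolding M(2) S(2) .
  qed (fact W Z)+
next
  assume "mostow_factors Z W P1 P2"
  then interpret mostow_factors Z W P1 P2 .
  obtain L where L: "mstar L = L" "mat_exp L = P1" by (rule pd_log_exists[OF P1])
  obtain M where M: "mstar M = M" "mat_exp M = P2" by (rule pd_log_exists[OF P2])
  have cL: "mstar (mconj L) = mconj L" "mstar (- L) = - L" "mstar (mconj M) = mconj M"
    using L(1) M(1) by (simp_all add: mstar_mconj mstar_minus)
  have "P1 ** mat_exp (- L) = mat 1" using mat_exp_hermitian(2)[OF L(1)] L(2) by simp
  then have "mat_exp (- L) = mconj P1" using matrix_inv_eqI(1) P1_inv by metis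
  then have "mat_exp (mconj L) = mat_exp (- L)" using mat_exp_hermitian(3)[OF L(1)] L(2) by simp
  then have Lc: "mconj L = - L" by (rule mat_exp_hermitian_inj[OF cL(1,2)])
  have "mat_exp (mconj M) = mat_exp M" using mat_exp_hermitian(3)[OF M(1)] M(2) P2_real by simp
  then have Mc: "mconj M = M" by (rule mat_exp_hermitian_inj[OF cL(3) M(1)])
  define K :: "real^'n^'n" where "K = (\<chi> i j. Im (L $ i $ j))"
  define S :: "real^'n^'n" where "S = (\<chi> i j. Re (M $ i $ j))"
  have Le: "Re (L $ i $ j) = 0" "Im (L $ j $ i) = - Im (L $ i $ j)" for i j
    using arg_cong[OF Lc, of "\<lambda>M. M $ i $ j"] arg_cong[OF L(1), of "\<lambda>M. M $ i $ j"]
    by (auto simp: complex_eq_iff)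
  have Me: "Im (M $ i $ j) = 0" "Re (M $ j $ i) = Re (M $ i $ j)" for i j
    using arg_cong[OF Mc, of "\<lambda>M. M $ i $ j"] arg_cong[OF M(1), of "\<lambda>M. M $ i $ j"]
    by (auto simp: complex_eq_iff)
  have "transpose K = - K" by (simp add: K_def transpose_def vec_eq_iff) (intro allI Le(2))
  moreover have "map_matrix (\<lambda>x. \<i> * complex_of_real x) K = L"
    by (simp add: K_def vec_eq_iff complex_eq_iff Le(1))
  moreover have "transpose S = S" by (simp add: S_def transpose_def vec_eq_iff) (intro allI Me(2))
  moreover have "map_matrix complex_of_real S = M"
    by (simp add: S_def vec_eq_iff complex_eq_iff Me(1))
  ultimately show "mostow_decomp Z W P1 P2"
    unfolding mostow_decomp_def using W L(2) M(2) Z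
    by (intro conjI exI[of _ K] exI[of _ S]) simp_all
qed

text \<open>\<open>P\<^sub>2\<^sup>2\<close> is the geometric mean of \<open>H = Z\<^sup>*Z\<close> and its conjugate, that is, the positive definite
  solution \<open>X\<close> of \<open>X H\<^sup>-\<^sup>1 X = conj H\<close>; here it is written as \<open>Z\<^sup>*RZ\<close>.\<close>
definition mostow_R :: "complex^'n^'n \<Rightarrow> complex^'n^'n"
  where "mostow_R Z = pd_sqrt (mstar (matrix_inv Z) ** mconj (mstar Z ** Z) ** matrix_inv Z)"

definition mostow_P2 :: "complex^'n^'n \<Rightarrow> complex^'n^'n"
  where "mostow_P2 Z = pd_sqrt (mstar Z ** mostow_R Z ** Z)"

definition mostow_P1 :: "complex^'n^'n \<Rightarrow> complex^'n^'n"
  where "mostow_P1 Z = pd_sqrt (matrix_inv (mostow_P2 Z) ** (mstar Z ** Z) ** matrix_inv (mostow_P2 Z))"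

definition mostow_W :: "complex^'n^'n \<Rightarrow> complex^'n^'n"
  where "mostow_W Z = Z ** matrix_inv (mostow_P2 Z) ** matrix_inv (mostow_P1 Z)"

lemma invertible_matrix_inv': "invertible A \<Longrightarrow> invertible (matrix_inv A)"
  for A :: "complex^'n^'n"
  using invertible_matrix_inv invertible_def by blast

context mostow_factors
begin

text \<open>With V = Z^-1, the inverse of H is \<open>V ** mstar V\<close>, so the Riccati equation
  says that \<open>mstar V ** X ** V\<close> squares to \<open>mstar V ** mconj H ** V\<close>.
  Together with the formulas for the three factors this yields uniqueness: any decomposition is
  given by these expressions.\<close>

lemma mostow_R_eq: "mostow_R Z = mstar (matrix_inv Z) ** (P2 ** P2) ** matrix_inv Z" (is "_ = ?R")
proof -
  have "pd ?R"
    by (intro pd_congruence pd_mult_self P2 invertible_matrix_inv' invertible_Z)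
  moreover have "?R ** ?R = mstar (matrix_inv Z) ** mconj (mstar Z ** Z) ** matrix_inv Z"
    unfolding mconj_gram matrix_inv_Z
    by (simp add: mstar_mult hermitian matrix_cancels flip: matrix_mul_assoc)
  ultimately show ?thesis unfolding mostow_R_def using pd_sqrt_mult_self by metis
qed

lemma mostow_P2_eq: "mostow_P2 Z = P2"
proof -
  have "mstar Z ** mostow_R Z ** Z = P2 ** P2"
    unfolding mostow_R_eq unfolding matrix_inv_Z mstar_Z
    by (simp add: Z mstar_mult hermitian matrix_cancels flip: matrix_mul_assoc)
  then show ?thesis unfolding mostow_P2_def by (simp add: pd_sqrt_mult_self P2)
qed

lemma mostow_P1_eq: "mostow_P1 Z = P1"
proof -
  have "V2 ** (mstar Z ** Z) ** V2 = P1 ** P1"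
    unfolding gram by (simp add: matrix_cancels flip: matrix_mul_assoc)
  then show ?thesis unfolding mostow_P1_def mostow_P2_eq by (simp add: pd_sqrt_mult_self P1)
qed

lemma mostow_W_eq: "mostow_W Z = W"
  unfolding mostow_W_def mostow_P1_eq mostow_P2_eq P1_inv
  by (simp add: Z matrix_cancels flip: matrix_mul_assoc)

end

text \<open>Beyond the existence of roots two facts need proof: X is real, and conj P1 is the
  inverse of P1. Both come from the Riccati equation \<open>Ric\<close> and uniqueness of positive
  definite roots.\<close>

lemma mostow_factors_exist:
  assumes inv: "invertible Z"
  shows "mostow_factors Z (mostow_W Z) (mostow_P1 Z) (mostow_P2 Z)"
proof -
  define V where "V = matrix_inv Z"
  define H where "H = mstar Z ** Z"
  define R where "R = mostow_R Z"
  define X where "X = mstar Z ** R ** Z"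
  note ZV = invertible_matrix_inv[OF inv, folded V_def]
  have ZVs: "mstar V ** mstar Z = mat 1" "mstar Z ** mstar V = mat 1"
    using ZV by (simp_all flip: mstar_mult)
  note cancels = ZV ZVs ZV[THEN matrix_cancel_left] ZVs[THEN matrix_cancel_left]
  have invV: "invertible V" unfolding V_def by (rule invertible_matrix_inv'[OF inv])
  have H: "pd H" unfolding H_def by (rule pd_mstar_mult_self[OF inv])
  have R: "pd R" "R ** R = mstar V ** mconj H ** V"
    unfolding R_def mostow_R_def H_def[symmetric] V_def[symmetric]
    using pd_sqrt[OF pd_congruence[OF pd_mconj[OF H] invV]] by auto
  have X: "pd X" unfolding X_def by (rule pd_congruence[OF R(1) inv])
  have RX: "R = mstar V ** X ** V"
    by (simp add: X_def cancels flip: matrix_mul_assoc)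
  have Ric: "X ** (V ** mstar V) ** X = mconj H"
  proof -
    have "X ** (V ** mstar V) ** X = mstar Z ** (R ** R) ** Z"
      by (simp add: X_def cancels flip: matrix_mul_assoc)
    then show ?thesis unfolding R(2) by (simp add: cancels flip: matrix_mul_assoc)
  qed
  have HV: "H ** (V ** mstar V) = mat 1" "(V ** mstar V) ** H = mat 1"
    by (simp_all add: H_def cancels flip: matrix_mul_assoc)
  \<comment> \<open>Conjugating \<open>Ric\<close> gives H = C E C with C = conj X and E =
    conj(H^-1). Swapping the order of two mutually inverse factors turns this into C H^-1 C = conj
    H, the equation of X itself; uniqueness of the root \<open>R\<close> then identifies C with
    X.\<close>
  have real: "mconj X = X"
  proof -
    let ?C = "mconj X" and ?R = "mstar V ** mconj X ** V"
    have C: "pd ?C" by (rule pd_mconj[OF X])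
    define E where "E = mconj (V ** mstar V)"
    have H_eq: "H = ?C ** E ** ?C"
      using arg_cong[OF Ric, of mconj] by (simp add: mconj_mult E_def)
    have "(?C ** E) ** (?C ** (V ** mstar V)) = mat 1"
      using HV(1) unfolding H_eq by (simp add: matrix_mul_assoc)
    from matrix_inv_eqI(3)[OF this] have "(?C ** (V ** mstar V) ** ?C) ** E = mat 1"
      by (simp add: matrix_mul_assoc)
    then have "matrix_inv E = ?C ** (V ** mstar V) ** ?C"
      by (rule matrix_inv_eqI(1)[OF matrix_inv_eqI(3)])
    moreover have "mconj H ** E = mat 1"
      using arg_cong[OF HV(1), of mconj] by (simp add: mconj_mult E_def)
    then have "matrix_inv E = mconj H" by (rule matrix_inv_eqI(1)[OF matrix_inv_eqI(3)])
    ultimately have "?C ** (V ** mstar V) ** ?C = mconj H" by simp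
    moreover have "?R ** ?R = mstar V ** (?C ** (V ** mstar V) ** ?C) ** V"
      by (simp add: matrix_mul_assoc)
    ultimately have "?R ** ?R = mstar V ** mconj H ** V" by simp
    then have R_eq: "?R = R"
      using pd_square_root_unique[OF R(1) pd_congruence[OF C invV]] R(2) by simp
    have "mstar Z ** ?R ** Z = X" by (subst R_eq) (rule X_def[symmetric])
    then show ?thesis by (simp add: cancels flip: matrix_mul_assoc)
  qed
  define P2 where "P2 = mostow_P2 Z"
  have P2: "pd P2" "P2 ** P2 = X"
    unfolding P2_def mostow_P2_def R_def[symmetric] X_def[symmetric] using pd_sqrt[OF X] by auto
  have "mconj P2 ** mconj P2 = mconj X" unfolding P2(2)[symmetric] by (rule mconj_mult[symmetric])
  then have "mconj P2 ** mconj P2 = P2 ** P2" unfolding real P2(2) .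
  then have P2_real: "mconj P2 = P2" using pd_square_root_unique[OF P2(1) pd_mconj[OF P2(1)]] by blast
  define V2 where "V2 = matrix_inv P2"
  note PV = invertible_matrix_inv[OF pd_invertible[OF P2(1)], folded V2_def]
  have V2: "pd V2" unfolding V2_def by (rule pd_inv[OF P2(1)])
  define P1 where "P1 = mostow_P1 Z"
  have "pd (V2 ** H ** V2)"
    using pd_congruence[OF H pd_invertible[OF V2]] pd_hermitian[OF V2] by simp
  then have P1: "pd P1" "P1 ** P1 = V2 ** H ** V2"
    unfolding P1_def mostow_P1_def P2_def[symmetric] V2_def[symmetric] H_def[symmetric]
    using pd_sqrt by auto
  have V2_real: "mconj V2 = V2"
  proof -
    have "P2 ** mconj V2 = mat 1" using arg_cong[OF PV(1), of mconj] by (simp add: mconj_mult P2_real)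
    from matrix_inv_eqI(1)[OF this] show ?thesis unfolding V2_def[symmetric] by (rule sym)
  qed
  define V1 where "V1 = matrix_inv P1"
  note QV = invertible_matrix_inv[OF pd_invertible[OF P1(1)], folded V1_def]
  have V1: "pd V1" unfolding V1_def by (rule pd_inv[OF P1(1)])
  \<comment> \<open>By \<open>Ric\<close>, conj H = P2^2 H^-1 P2^2, so conj(P1)^2 = P2 H^-1 P2,
    which is the inverse of P2^-1 H P2^-1 = P1^2.\<close>
  have P1_conj: "mconj P1 = V1"
  proof -
    have "mconj P1 ** mconj P1 = V2 ** mconj H ** V2"
      using arg_cong[OF P1(2), of mconj] by (simp add: mconj_mult V2_real)
    also have "\<dots> = P2 ** (V ** mstar V) ** P2"
      unfolding Ric[symmetric] P2(2)[symmetric]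
      by (simp add: PV PV[THEN matrix_cancel_left] flip: matrix_mul_assoc)
    also have "\<dots> = V1 ** V1"
    proof -
      have "(P1 ** P1) ** (P2 ** (V ** mstar V) ** P2) = mat 1"
        unfolding P1(2) using PV HV(1)[THEN matrix_cancel_left]
        by (simp add: PV[THEN matrix_cancel_left] flip: matrix_mul_assoc)
      then have "matrix_inv (P1 ** P1) = P2 ** (V ** mstar V) ** P2" by (rule matrix_inv_eqI(1))
      moreover have "(P1 ** P1) ** (V1 ** V1) = mat 1"
        by (simp add: QV QV[THEN matrix_cancel_left] flip: matrix_mul_assoc)
      then have "matrix_inv (P1 ** P1) = V1 ** V1" by (rule matrix_inv_eqI(1))
      ultimately show ?thesis by (rule trans[OF sym])
    qed
    finally show ?thesis using pd_square_root_unique[OF V1 pd_mconj[OF P1(1)]] by blast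
  qed
  define W where "W = mostow_W Z"
  have W: "W = Z ** V2 ** V1"
    unfolding W_def mostow_W_def P1_def[symmetric] P2_def[symmetric] V1_def[symmetric] V2_def[symmetric] ..
  have "mstar W ** W = V1 ** (V2 ** H ** V2) ** V1"
    by (simp add: W mstar_mult pd_hermitian[OF V1] pd_hermitian[OF V2] H_def flip: matrix_mul_assoc)
  also have "\<dots> = mat 1"
    unfolding P1(2)[symmetric] by (simp add: QV QV[THEN matrix_cancel_left] flip: matrix_mul_assoc)
  finally have "unitary_mat W" by (rule unitary_matI)
  moreover have "Z = W ** P1 ** P2"
    by (simp add: W PV QV PV[THEN matrix_cancel_left] QV[THEN matrix_cancel_left] flip: matrix_mul_assoc)
  ultimately show ?thesis
    unfolding W_def[symmetric] P1_def[symmetric] P2_def[symmetric]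
    using P1(1) P2(1) P2_real QV(2) P1_conj by (simp add: mostow_factors_def)
qed

lemma mostow_rho_eq:
  assumes "invertible Z"
  shows "mostow_rho0 Z = mostow_W Z" "mostow_rho1 Z = mostow_P1 Z" "mostow_rho2 Z = mostow_P2 Z"
proof -
  note ex = mostow_factors_exist[OF assms]
  note un = mostow_factors.mostow_W_eq mostow_factors.mostow_P1_eq mostow_factors.mostow_P2_eq
  show "mostow_rho0 Z = mostow_W Z" unfolding mostow_rho0_def mostow_decomp_iff
    by (rule the_equality) (use ex un in blast)+
  show "mostow_rho1 Z = mostow_P1 Z" unfolding mostow_rho1_def mostow_decomp_iff
    by (rule the_equality) (use ex un in blast)+
  show "mostow_rho2 Z = mostow_P2 Z" unfolding mostow_rho2_def mostow_decomp_iff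
    by (rule the_equality) (use ex un in blast)+
qed

section \<open>Differentiability of the factors and the induced norms\<close>

lemma differentiable_matrix_mult:
  fixes f g :: "'a::real_normed_vector \<Rightarrow> complex^'n^'n"
  shows "f differentiable (at x) \<Longrightarrow> g differentiable (at x) \<Longrightarrow> (\<lambda>y. f y ** g y) differentiable (at x)"
  unfolding differentiable_def using bounded_bilinear.FDERIV[OF bounded_bilinear_matrix_mult] by blast

lemma differentiable_mstar:
  fixes f :: "'a::real_normed_vector \<Rightarrow> complex^'n^'n"
  shows "f differentiable (at x) \<Longrightarrow> (\<lambda>y. mstar (f y)) differentiable (at x)"
  unfolding differentiable_def using bounded_linear.has_derivative[OF bounded_linear_mstar] by blast

lemma differentiable_mconj:
  fixes f :: "'a::real_normed_vector \<Rightarrow> complex^'n^'n"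
  shows "f differentiable (at x) \<Longrightarrow> (\<lambda>y. mconj (f y)) differentiable (at x)"
  unfolding differentiable_def using bounded_linear.has_derivative[OF bounded_linear_mconj] by blast

lemma differentiable_matrix_inv:
  fixes f :: "'a::real_normed_vector \<Rightarrow> complex^'n^'n"
  shows "f differentiable (at x) \<Longrightarrow> invertible (f x) \<Longrightarrow> (\<lambda>y. matrix_inv (f y)) differentiable (at x)"
  unfolding differentiable_def using has_derivative_compose[OF _ matrix_inv_has_derivative] by blast

lemma differentiable_pd_sqrt:
  fixes f :: "'a::real_normed_vector \<Rightarrow> complex^'n^'n"
  shows "f differentiable (at x) \<Longrightarrow> \<forall>\<^sub>F y in nhds x. pd (f y) \<Longrightarrow> (\<lambda>y. pd_sqrt (f y)) differentiable (at x)"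
  unfolding differentiable_def using pd_sqrt_has_derivative by blast

text \<open>The explicit formulas involve only products, adjoints, conjugates, inverses and positive
  definite roots. The rule for roots asks for positivity on a neighbourhood, which openness of the
  invertible matrices provides.\<close>

lemma mostow_differentiable:
  fixes Z :: "complex^'n^'n"
  assumes Z: "invertible Z"
  shows "mostow_W differentiable (at Z)" "mostow_P1 differentiable (at Z)" "mostow_P2 differentiable (at Z)"
proof -
  note ev = eventually_invertible[OF Z]
  have pd1: "pd (mstar (matrix_inv Y) ** mconj (mstar Y ** Y) ** matrix_inv Y)" if "invertible Y" for Y :: "complex^'n^'n"
    by (intro pd_congruence pd_mconj pd_mstar_mult_self invertible_matrix_inv' that)
  have pdR: "pd (mstar Y ** mostow_R Y ** Y)" if "invertible Y" for Y :: "complex^'n^'n"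
    unfolding mostow_R_def by (intro pd_congruence pd_sqrt pd1 that)
  have pdP2: "pd (mostow_P2 Y)" if "invertible Y" for Y :: "complex^'n^'n"
    unfolding mostow_P2_def by (intro pd_sqrt pdR that)
  have pdT: "pd (matrix_inv (mostow_P2 Y) ** (mstar Y ** Y) ** matrix_inv (mostow_P2 Y))"
    if "invertible Y" for Y :: "complex^'n^'n"
    using pd_congruence[OF pd_mstar_mult_self[OF that] pd_invertible[OF pd_inv[OF pdP2[OF that]]]]
      pd_hermitian[OF pd_inv[OF pdP2[OF that]]] by simp
  have pdP1: "pd (mostow_P1 Z)" unfolding mostow_P1_def by (intro pd_sqrt pdT Z)
  have id: "(\<lambda>Y. Y) differentiable (at Z)" by simp
  note intros = differentiable_matrix_mult differentiable_mstar differentiable_mconj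
  have "mostow_R differentiable (at Z)"
    unfolding mostow_R_def[abs_def]
    by (intro differentiable_pd_sqrt intros differentiable_matrix_inv[OF id Z] id eventually_mono[OF ev pd1])
  then show P2: "mostow_P2 differentiable (at Z)"
    unfolding mostow_P2_def[abs_def]
    by (intro differentiable_pd_sqrt intros id eventually_mono[OF ev pdR])
  note P2i = differentiable_matrix_inv[OF P2 pd_invertible[OF pdP2[OF Z]]]
  show P1: "mostow_P1 differentiable (at Z)"
    unfolding mostow_P1_def[abs_def]
    by (intro differentiable_pd_sqrt intros id P2i eventually_mono[OF ev pdT])
  show "mostow_W differentiable (at Z)"
    unfolding mostow_W_def[abs_def]
    by (intro intros id P2i differentiable_matrix_inv[OF P1 pd_invertible[OF pdP1]])
qed

lemma has_derivative_eventually_eq: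
  assumes "(f has_derivative f') (at x)" "\<forall>\<^sub>F y in nhds x. f y = g y"
  shows "(g has_derivative f') (at x)"
  using assms(1) by (rule has_derivative_transform_eventually)
    (use assms(2) in \<open>auto simp: eventually_at_filter elim: eventually_mono dest: eventually_nhds_x_imp_x\<close>)

lemma has_derivative_unique_eventually:
  assumes "(f has_derivative f') (at x)" "(g has_derivative g') (at x)" "\<forall>\<^sub>F y in nhds x. f y = g y"
  shows "f' = g'"
  using has_derivative_eventually_eq[OF assms(1,3)] assms(2) by (rule has_derivative_unique)

lemma differentiable_eventually_eq:
  assumes "f differentiable (at x)" "\<forall>\<^sub>F y in nhds x. f y = g y"
  shows "(g has_derivative frechet_derivative g (at x)) (at x)"
proof -
  have "g differentiable (at x)"
    using assms has_derivative_eventually_eq unfolding differentiable_def by blast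
  then show ?thesis by (simp add: frechet_derivative_works)
qed

text \<open>Each defining identity of the factors holds on a whole neighbourhood of
  \<open>Z\<close>, so by uniqueness of derivatives it may be differentiated on both sides.\<close>

lemma mostow_tangent_derivative:
  fixes Z :: "complex^'n^'n"
  assumes N: "unitarily_invariant_norm N" and dec: "mostow_decomp Z W P1 P2"
  shows "mostow_tangent Z W P1 P2 N A (frechet_derivative mostow_rho0 (at Z) A)
    (frechet_derivative mostow_rho1 (at Z) A) (frechet_derivative mostow_rho2 (at Z) A)"
proof -
  interpret mostow_factors Z W P1 P2 using dec by (simp add: mostow_decomp_iff)
  note Zi = invertible_Z
  let ?w = mostow_rho0 and ?p = mostow_rho1 and ?q = mostow_rho2
  define D0 D1 D2 where "D0 = frechet_derivative ?w (at Z)" and "D1 = frechet_derivative ?p (at Z)"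
    and "D2 = frechet_derivative ?q (at Z)"
  have fac: "mostow_factors Y (?w Y) (?p Y) (?q Y)" if "invertible Y" for Y :: "complex^'n^'n"
    using mostow_factors_exist[OF that] by (simp add: mostow_rho_eq that)
  have ev: "\<forall>\<^sub>F Y in nhds Z. mostow_factors Y (?w Y) (?p Y) (?q Y)"
    by (rule eventually_mono[OF eventually_invertible[OF Zi] fac])
  have val: "?w Z = W" "?p Z = P1" "?q Z = P2"
    using Zi by (simp_all add: mostow_rho_eq mostow_W_eq mostow_P1_eq mostow_P2_eq)
  have eq: "\<forall>\<^sub>F Y in nhds Z. mostow_W Y = ?w Y" "\<forall>\<^sub>F Y in nhds Z. mostow_P1 Y = ?p Y"
    "\<forall>\<^sub>F Y in nhds Z. mostow_P2 Y = ?q Y"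
    using eventually_invertible[OF Zi] by (auto elim!: eventually_mono simp: mostow_rho_eq)
  have D0: "(?w has_derivative D0) (at Z)" and D1: "(?p has_derivative D1) (at Z)"
    and D2: "(?q has_derivative D2) (at Z)"
    unfolding D0_def D1_def D2_def
    by (rule differentiable_eventually_eq[OF mostow_differentiable(1)[OF Zi] eq(1)]
        differentiable_eventually_eq[OF mostow_differentiable(2)[OF Zi] eq(2)]
        differentiable_eventually_eq[OF mostow_differentiable(3)[OF Zi] eq(3)])+
  note mult = bounded_bilinear.FDERIV[OF bounded_bilinear_matrix_mult]
  note star = bounded_linear.has_derivative[OF bounded_linear_mstar]
  note conj = bounded_linear.has_derivative[OF bounded_linear_mconj]
  note const = has_derivative_const
  have 1: "(\<lambda>h. h) = (\<lambda>h. (?w Z ** ?p Z) ** D2 h + (?w Z ** D1 h + D0 h ** ?p Z) ** ?q Z)"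
    by (rule has_derivative_unique_eventually[OF has_derivative_ident mult[OF mult[OF D0 D1] D2]])
      (auto intro!: eventually_mono[OF ev] mostow_factors.Z)
  have 2: "(\<lambda>h. mstar (?w Z) ** D0 h + mstar (D0 h) ** ?w Z) = (\<lambda>h. 0)"
    by (rule has_derivative_unique_eventually[OF mult[OF star[OF D0] D0] const[of "mat 1"]])
      (auto intro!: eventually_mono[OF ev] unitaryD(1) mostow_factors.W)
  have 3: "(\<lambda>h. mstar (D1 h)) = D1"
    by (rule has_derivative_unique_eventually[OF star[OF D1] D1])
      (auto intro!: eventually_mono[OF ev] pd_hermitian mostow_factors.P1)
  have 4: "(\<lambda>h. mconj (?p Z) ** D1 h + mconj (D1 h) ** ?p Z) = (\<lambda>h. 0)"
    by (rule has_derivative_unique_eventually[OF mult[OF conj[OF D1] D1] const[of "mat 1"]])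
      (auto intro!: eventually_mono[OF ev] mostow_factors.P1_conj)
  have 5: "(\<lambda>h. mstar (D2 h)) = D2"
    by (rule has_derivative_unique_eventually[OF star[OF D2] D2])
      (auto intro!: eventually_mono[OF ev] pd_hermitian mostow_factors.P2)
  have 6: "(\<lambda>h. mconj (D2 h)) = D2"
    by (rule has_derivative_unique_eventually[OF conj[OF D2] D2])
      (auto intro!: eventually_mono[OF ev] mostow_factors.P2_real)
  show ?thesis
    unfolding D0_def[symmetric] D1_def[symmetric] D2_def[symmetric]
  proof unfold_locales
    show "unitarily_invariant_norm N" by fact
    show "A = W ** P1 ** D2 A + (W ** D1 A + D0 A ** P1) ** P2" using fun_cong[OF 1, of A] unfolding val .
    show "mstar W ** D0 A + mstar (D0 A) ** W = 0" using fun_cong[OF 2, of A] unfolding val .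
    show "mstar (D1 A) = D1 A" using fun_cong[OF 3, of A] .
    show "mconj P1 ** D1 A + mconj (D1 A) ** P1 = 0" using fun_cong[OF 4, of A] unfolding val .
    show "mstar (D2 A) = D2 A" using fun_cong[OF 5, of A] .
    show "mconj (D2 A) = D2 A" using fun_cong[OF 6, of A] .
  qed
qed

text \<open>Bounding a real supremum requires a nonempty index set; the identity matrix, normalised
  for \<open>N\<close>, provides a member.\<close>

lemma deriv_norm_leI:
  assumes "unitarily_invariant_norm N" and "\<And>A. N (frechet_derivative f (at Z) A) \<le> b * N A"
  shows "deriv_norm N f Z \<le> b"
proof -
  interpret ui_norm N by unfold_locales fact
  have "mat 1 \<noteq> (0 :: complex^'a^'a)" by (simp add: vec_eq_iff mat_def)
  then have "N (mat 1) \<noteq> 0" by (simp add: N_eq_0)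
  then have "N ((1 / N (mat 1)) *\<^sub>R mat 1) = 1" by (simp add: N_scaleR N_nonneg)
  then have "{A. N A = 1} \<noteq> {}" by blast
  then show ?thesis unfolding deriv_norm_def
  proof (rule cSUP_least)
    show "N (frechet_derivative f (at Z) A) \<le> b" if "A \<in> {A. N A = 1}" for A
      using assms(2)[of A] that by simp
  qed
qed

theorem theorem3p1:
  fixes N :: "complex^'n^'n \<Rightarrow> real"
    and Z W P1 P2 :: "complex^'n^'n"
  assumes "unitarily_invariant_norm N"
    and "invertible Z"
    and "mostow_decomp Z W P1 P2"
  shows "deriv_norm N mostow_rho0 Z \<le>
          op_norm (matrix_inv P1) * op_norm (matrix_inv P2) / 2 *
            (1 + op_norm P1 * mostow_beta Z * cond_num Z * (1 + cond_num Z ^ 4))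
      \<and> deriv_norm N mostow_rho1 Z \<le>
          cond_num P1 * op_norm (matrix_inv P2) / 2 *
            (1 + op_norm P1 * mostow_beta Z * cond_num Z * (1 + cond_num Z ^ 4))
      \<and> deriv_norm N mostow_rho2 Z \<le>
          mostow_beta Z * cond_num Z * (1 + cond_num Z ^ 4)"
proof (intro conjI; rule deriv_norm_leI[OF assms(1)])
  fix A
  interpret mostow_tangent Z W P1 P2 N A "frechet_derivative mostow_rho0 (at Z) A"
    "frechet_derivative mostow_rho1 (at Z) A" "frechet_derivative mostow_rho2 (at Z) A"
    by (rule mostow_tangent_derivative[OF assms(1,3)])
  show "N (frechet_derivative mostow_rho0 (at Z) A) \<le> op_norm (matrix_inv P1) * op_norm (matrix_inv P2) / 2 *
            (1 + op_norm P1 * mostow_beta Z * cond_num Z * (1 + cond_num Z ^ 4)) * N A"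
    using N_d0 unfolding P1_inv .
  show "N (frechet_derivative mostow_rho1 (at Z) A) \<le> cond_num P1 * op_norm (matrix_inv P2) / 2 *
            (1 + op_norm P1 * mostow_beta Z * cond_num Z * (1 + cond_num Z ^ 4)) * N A"
    by (rule N_d1)
  show "N (frechet_derivative mostow_rho2 (at Z) A) \<le> mostow_beta Z * cond_num Z * (1 + cond_num Z ^ 4) * N A"
    by (rule N_d2')
qed

end
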